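(* Let $(a_i^{(N)})_{i\ge1}$ and $(b_i^{(N)})_{i\ge1}$ be independent sequences of independent real random variables, possibly depending on $N$. Assume that for $N$ large enough $(a_i^{(N)})_{i\ge1}$ and $(\sqrt2\,b_i^{(N)})_{i\ge1}$ have uniform Gaussian tail. Consider the tridiagonal model $J=T(a_1^{(N)},\dots,a_N^{(N)},b_1^{(N)},\dots,b_{N-1}^{(N)})$ or the periodic tridiagonal model $J=T_{\mathsf{per}}(a_1^{(N)},\dots,a_N^{(N)},b_1^{(N)},\dots,b_N^{(N)})$. Then $\lambda_{\max}(J)/\sqrt{2\log N}$ satisfies a large deviation principle (LDP) at speed $\log N$ with rate function $I_2$.
   Context: Uniform Gaussian tail: a family of real random variables $(X_i)_{i\in I}$ ($I$ any index set) has uniform Gaussian tail if for all $i\in I$, as $x\to+\infty$, $$-\log\mathbb{P}(|X_i|>x)=\tfrac{x^2}{2}+o(x^2)\quad\text{and}\quad-\log\mathbb{P}(X_i>x)=\tfrac{x^2}{2}+o(x^2),$$ where the remainder term $o(x^2)$ is bounded independently of $i\in I$. $T(a_1,\dots,a_N,b_1,\dots,b_{N-1})$ is the real symmetric $N\times N$ tridiagonal matrix with diagonal entries $T_{i,i}=a_i$, off-diagonal entries $T_{i,i+1}=T_{i+1,i}=b_i$ for $1\le i\le N-1$, and other entries $0$. $T_{\mathsf{per}}(a_1,\dots,a_N,b_1,\dots,b_N)$ is the same matrix with in addition corner entries $b_N$ at positions $(1,N)$ and $(N,1)$. $\lambda_{\max}$ denotes the largest eigenvalue. $I_2:\mathbb{R}\to[0,+\infty]$,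 $I_2(x)=x^2-1$ if $x\ge1$, $I_2(x)=+\infty$ if $x<1$. A sequence $(Y_N)$ of real random variables satisfies a (full) LDP with speed $a_N\to+\infty$ and rate function $I$ (lower semicontinuous) if $-\inf_U I\le\liminf_N\frac1{a_N}\log\mathbb{P}(Y_N\in U)$ for every open $U\subset\mathbb{R}$ and $\limsup_N\frac1{a_N}\log\mathbb{P}(Y_N\in F)\le-\inf_F I$ for every closed $F\subset\mathbb{R}$.
   Formalization: The uniform Gaussian tail is assumed with a remainder o(x²) bounded independently of both i and N (for N large enough), not only of i for each N; otherwise a_i^(N) = g_i + N, with g_i standard Gaussian, is a counterexample. *)

theory Defs
  imports "HOL-Probability.Probability" "HOL-Library.Landau_Symbols"
    "Jordan_Normal_Form.Spectral_Radius"
begin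

text \<open>Logarithm with values in the extended reals, so that the logarithm of a null
  probability is \<open>-\<infinity>\<close> (the library has \<open>ln 0 = 0\<close> on the reals).\<close>

definition elog :: "real \<Rightarrow> ereal" where
  "elog p = (if p > 0 then ereal (ln p) else - \<infinity>)"

text \<open>The variables may live on different probability spaces: \<open>X i\<close> is a random variable on
  \<open>M i\<close>. A single function \<open>r\<close> dominates the remainders of all members of the family, from a
  common threshold on.\<close>

definition uniform_gaussian_tail ::
  "'i set \<Rightarrow> ('i \<Rightarrow> 'a measure) \<Rightarrow> ('i \<Rightarrow> 'a \<Rightarrow> real) \<Rightarrow> bool" where
  "uniform_gaussian_tail I M X \<longleftrightarrow>
    (\<exists>r :: real \<Rightarrow> real. r \<in> o[at_top](\<lambda>x. x\<^sup>2) \<and>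
      (\<forall>\<^sub>F x in at_top. \<forall>i\<in>I.
        \<bar>- elog (measure (M i) {\<omega> \<in> space (M i). \<bar>X i \<omega>\<bar> > x}) - ereal (x\<^sup>2 / 2)\<bar> \<le> ereal (r x) \<and>
        \<bar>- elog (measure (M i) {\<omega> \<in> space (M i). X i \<omega> > x}) - ereal (x\<^sup>2 / 2)\<bar> \<le> ereal (r x)))"

text \<open>Sequences are indexed from 1, whereas the rows and columns of a matrix are numbered from 0.\<close>

definition tridiag :: "nat \<Rightarrow> (nat \<Rightarrow> real) \<Rightarrow> (nat \<Rightarrow> real) \<Rightarrow> real mat" where
  "tridiag N a b = mat N N (\<lambda>(i, j).
     if i = j then a (i + 1)
     else if j = i + 1 then b (i + 1)
     else if i = j + 1 then b (j + 1)
     else 0)"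

text \<open>For \<open>N \<ge> 3\<close> the corners are distinct from the entries of the tridiagonal part; for smaller
  \<open>N\<close> the corner value \<open>b N\<close> takes precedence.\<close>

definition tridiag_per :: "nat \<Rightarrow> (nat \<Rightarrow> real) \<Rightarrow> (nat \<Rightarrow> real) \<Rightarrow> real mat" where
  "tridiag_per N a b = mat N N (\<lambda>(i, j).
     if (i = 0 \<and> j = N - 1) \<or> (i = N - 1 \<and> j = 0) then b N
     else tridiag N a b $$ (i, j))"

definition lambda_max :: "real mat \<Rightarrow> real" where
  "lambda_max A = Max (spectrum A)"

definition I2 :: "real \<Rightarrow> ereal" where
  "I2 x = (if x \<ge> 1 then ereal (x\<^sup>2 - 1) else \<infinity>)"

text \<open>\<open>Y N\<close> is a random variable on the probability space \<open>M N\<close>. Lower semicontinuity of the rate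
  function \<open>I\<close> is expressed by closedness of its sublevel sets.\<close>

definition satisfies_LDP ::
  "(nat \<Rightarrow> 'a measure) \<Rightarrow> (nat \<Rightarrow> 'a \<Rightarrow> real) \<Rightarrow> (nat \<Rightarrow> real) \<Rightarrow> (real \<Rightarrow> ereal) \<Rightarrow> bool" where
  "satisfies_LDP M Y s I \<longleftrightarrow>
    filterlim s at_top sequentially \<and>
    (\<forall>x. 0 \<le> I x) \<and> (\<forall>c. closed {x. I x \<le> c}) \<and>
    (\<forall>N. Y N \<in> borel_measurable (M N)) \<and>
    (\<forall>U. open U \<longrightarrow>
      - (INF x\<in>U. I x)
        \<le> liminf (\<lambda>N. elog (measure (M N) {\<omega> \<in> space (M N). Y N \<omega> \<in> U}) / ereal (s N))) \<and>
    (\<forall>F. closed F \<longrightarrow>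
      limsup (\<lambda>N. elog (measure (M N) {\<omega> \<in> space (M N). Y N \<omega> \<in> F}) / ereal (s N))
        \<le> - (INF x\<in>F. I x))"

end

theory Submission
  imports Defs "HOL-Real_Asymp.Real_Asymp" "HOL-Number_Theory.Cong"
begin

text \<open>The obstacle is the constant in the upper bound. A row-sum estimate
  \<open>\<bar>a i\<bar> + \<bar>b i\<bar> + \<bar>b (i - 1)\<bar>\<close> is too lossy: with cost
  \<open>x\<^sup>2 / 2\<close> for an \<open>a\<close> and \<open>x\<^sup>2\<close> for a
  \<open>b\<close>, Cauchy-Schwarz lets such a sum reach \<open>x sqrt (2 log N)\<close> at half the
  correct cost, so the exponent would be \<open>1 - x\<^sup>2 / 2\<close>. The Hilbert-Schmidt norm
  has the right constant, since a single large diagonal entry attains it, and it counts each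
  \<open>b\<close> twice, which matches the assumption on \<open>sqrt 2 * b\<close>: the terms
  \<open>a i\<^sup>2\<close> and \<open>2 * b i\<^sup>2\<close> all have the same exponential rate,
  and a sum of boundedly many independent ones keeps it. For the whole matrix the norm would add up
  order \<open>N\<close> many terms and drown the scale \<open>log N\<close>; hence the windows.

  The window length is fixed before \<open>N\<close> grows. Its moment factor is then a constant,
  absorbed by a small power of \<open>N\<close>, and the loss of order \<open>1 / k\<close> is
  removed only afterwards, through the arbitrary \<open>\<epsilon>\<close> in the exponent. One
  large diagonal entry being the cheapest way to a large eigenvalue, the lower bound needs no
  off-diagonal information.\<close>

text \<open>
  Both models satisfy two deterministic bounds. From below, \<open>\<lambda>\<^sub>m\<^sub>a\<^sub>x\<close> dominates every diagonal entry. From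
  above, averaging the quadratic form over all cyclic windows of \<open>k\<close> consecutive sites loses only a
  fraction \<open>1 / k\<close> of the off-diagonal part, so \<open>\<lambda>\<^sub>m\<^sub>a\<^sub>x \<le> (1 + 2 / k) S\<close>, where \<open>S\<^sup>2\<close> is the maximum
  over the windows of the sum of \<open>a\<^sub>i\<^sup>2 + 2 b\<^sub>i\<^sup>2\<close>, which bounds the squared Hilbert--Schmidt norm.
  By independence and the tail assumption, \<open>exp (\<theta> (a\<^sub>i\<^sup>2 + 2 b\<^sub>i\<^sup>2) / 2)\<close> has bounded expectation for
  every \<open>\<theta> < 1\<close>, and a union bound over the \<open>N\<close> windows gives
  \<open>P (\<lambda>\<^sub>m\<^sub>a\<^sub>x \<ge> x sqrt (2 log N)) \<le> N powr (1 - x\<^sup>2 + o(1))\<close>. The maximum of the \<open>N\<close> independent diagonal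
  entries gives the matching lower bound and a superpolynomially small left tail.
\<close>

section \<open>Rayleigh quotients\<close>

no_notation inner (infix "\<bullet>" 70)

abbreviation sqnorm :: "real vec \<Rightarrow> real" where
  "sqnorm v \<equiv> v \<bullet> v"

lemma sqnorm_eq_sum: "sqnorm v = (\<Sum>i<dim_vec v. (v $ i)\<^sup>2)"
  by (simp add: scalar_prod_def atLeast0LessThan power2_eq_square)

lemma sqnorm_nonneg: "0 \<le> sqnorm v"
  by (simp add: sqnorm_eq_sum sum_nonneg)

lemma sqnorm_pos:
  assumes "v \<in> carrier_vec n" "v \<noteq> 0\<^sub>v n"
  shows "0 < sqnorm v"
proof -
  obtain i where i: "i < n" "v $ i \<noteq> 0"
    using assms by (metis carrier_vecD eq_vecI index_zero_vec)
  have "0 < (\<Sum>i<dim_vec v. (v $ i)\<^sup>2)"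
    by (rule sum_pos2[of _ i]) (use i assms in auto)
  then show ?thesis by (simp add: sqnorm_eq_sum)
qed

lemma scalar_prod_Cauchy_Schwarz:
  assumes "u \<in> carrier_vec n" "v \<in> carrier_vec n"
  shows "(u \<bullet> v)\<^sup>2 \<le> sqnorm u * sqnorm v"
  using assms Cauchy_Schwarz_ineq_sum[of "($) u" "($) v" "{..<n}"]
  by (simp add: sqnorm_eq_sum) (simp add: scalar_prod_def atLeast0LessThan)

lemma scalar_prod_le_sqnorm:
  fixes u v :: "real vec"
  assumes "u \<in> carrier_vec n" "v \<in> carrier_vec n"
  shows "u \<bullet> v \<le> (sqnorm u + sqnorm v) / 2"
proof -
  have "(\<Sum>i<n. u $ i * v $ i) \<le> (\<Sum>i<n. ((u $ i)\<^sup>2 + (v $ i)\<^sup>2) / 2)"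
    using sum_squares_bound[of "u $ i" "v $ i" for i] by (intro sum_mono) (simp add: field_simps)
  then show ?thesis
    using assms
    by (simp add: sqnorm_eq_sum sum.distrib flip: sum_divide_distrib)
      (simp add: scalar_prod_def atLeast0LessThan)
qed

lemma mult_mat_vec_bounded:
  fixes A :: "real mat"
  assumes A: "A \<in> carrier_mat n n"
  obtains K where "K > 0" "\<And>v. v \<in> carrier_vec n \<Longrightarrow> sqnorm (A *\<^sub>v v) \<le> K * sqnorm v"
proof
  \<comment> \<open>The squared Hilbert-Schmidt norm, from Cauchy-Schwarz row by row;
    \<open>K + 1\<close> is exported so that the constant is positive even for the zero
    matrix.\<close>
  define K where "K = (\<Sum>i<n. sqnorm (row A i))"
  have K0: "0 \<le> K" unfolding K_def by (intro sum_nonneg sqnorm_nonneg)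
  then show "K + 1 > 0" by simp
  fix v :: "real vec" assume v: "v \<in> carrier_vec n"
  have "sqnorm (A *\<^sub>v v) = (\<Sum>i<n. (row A i \<bullet> v)\<^sup>2)"
    using A by (simp add: sqnorm_eq_sum)
  also have "\<dots> \<le> (\<Sum>i<n. sqnorm (row A i) * sqnorm v)"
    using A v by (intro sum_mono scalar_prod_Cauchy_Schwarz[of _ n]) auto
  also have "\<dots> = K * sqnorm v" by (simp add: K_def sum_distrib_right)
  also have "\<dots> \<le> (K + 1) * sqnorm v"
    using sqnorm_nonneg[of v] by (simp add: mult_right_mono)
  finally show "sqnorm (A *\<^sub>v v) \<le> (K + 1) * sqnorm v" .
qed

text \<open>In the sense of forms this is \<open>B\<^sup>2 \<le> C B\<close>. It follows without
  diagonalisation, by testing semidefiniteness at \<open>v + t B v\<close> with the best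
  \<open>t\<close>. Its purpose is to turn invertibility of \<open>B\<close> into a positive lower
  bound for the form of \<open>B\<close>.\<close>

lemma psd_sqnorm_mult_le:
  fixes B :: "real mat"
  assumes B: "B \<in> carrier_mat n n" and sym: "transpose_mat B = B"
    and psd: "\<And>v. v \<in> carrier_vec n \<Longrightarrow> 0 \<le> v \<bullet> (B *\<^sub>v v)"
  obtains C where "C > 0" "\<And>v. v \<in> carrier_vec n \<Longrightarrow> sqnorm (B *\<^sub>v v) \<le> C * (v \<bullet> (B *\<^sub>v v))"
proof -
  obtain K where K: "K > 0" "\<And>v. v \<in> carrier_vec n \<Longrightarrow> sqnorm (B *\<^sub>v v) \<le> K * sqnorm v"
    using mult_mat_vec_bounded[OF B] by metis
  define C where "C = (1 + K) / 2"
  have C: "C > 0" using K by (simp add: C_def)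
  have "sqnorm (B *\<^sub>v v) \<le> C * (v \<bullet> (B *\<^sub>v v))" if v: "v \<in> carrier_vec n" for v
  proof -
    define w where "w = B *\<^sub>v v"
    have w: "w \<in> carrier_vec n" "B *\<^sub>v w \<in> carrier_vec n" using B v by (auto simp: w_def)
    \<comment> \<open>This \<open>t\<close> minimises
      \<open>v \<bullet> w + 2 * t * sqnorm w + t * t * C * sqnorm w\<close>, the upper bound
      reached below.\<close>
    define t where "t = - (1 / C)"
    have "w \<bullet> (B *\<^sub>v w) \<le> (sqnorm w + K * sqnorm w) / 2"
      using scalar_prod_le_sqnorm[OF w] K(2)[OF w(1)] by simp
    then have ww: "w \<bullet> (B *\<^sub>v w) \<le> C * sqnorm w" by (simp add: C_def algebra_simps)
    have vw: "v \<bullet> (B *\<^sub>v w) = sqnorm w"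
      using transpose_vec_mult_scalar[OF B w(1) v] by (simp add: sym flip: w_def)
    have "0 \<le> (v + t \<cdot>\<^sub>v w) \<bullet> (B *\<^sub>v (v + t \<cdot>\<^sub>v w))"
      using v w by (intro psd) auto
    also have "B *\<^sub>v (v + t \<cdot>\<^sub>v w) = w + t \<cdot>\<^sub>v (B *\<^sub>v w)"
      using B v w by (simp add: mult_add_distrib_mat_vec[of _ n n] mult_mat_vec[of _ n n] w_def)
    also have "(v + t \<cdot>\<^sub>v w) \<bullet> (w + t \<cdot>\<^sub>v (B *\<^sub>v w)) =
        v \<bullet> w + t * (v \<bullet> (B *\<^sub>v w)) + t * sqnorm w + t * t * (w \<bullet> (B *\<^sub>v w))"
      using v w by (simp add: add_scalar_prod_distrib[of _ n] scalar_prod_add_distrib[of _ n] algebra_simps)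
    also have "\<dots> \<le> v \<bullet> w + 2 * t * sqnorm w + t * t * (C * sqnorm w)"
      using mult_left_mono[OF ww, of "t * t"] by (simp add: vw)
    also have "\<dots> = v \<bullet> w - sqnorm w / C"
      using C by (simp add: t_def field_simps)
    finally show ?thesis using C by (simp add: w_def field_simps)
  qed
  with C show ?thesis using that by blast
qed

lemma char_matrix_mult_vec:
  fixes A :: "real mat"
  assumes "A \<in> carrier_mat n n" "v \<in> carrier_vec n"
  shows "char_matrix A e *\<^sub>v v = A *\<^sub>v v - e \<cdot>\<^sub>v v"
  using assms
  by (intro eq_vecI) (auto simp: char_matrix_def add_scalar_prod_distrib[of _ n])

text \<open>If the supremum \<open>m\<close> of the Rayleigh quotient were not an eigenvalue, then \<open>m - A\<close> would be
  positive semidefinite and invertible, hence bounded below, and \<open>m\<close> could be decreased.\<close>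

lemma lambda_max_rayleigh:
  fixes A :: "real mat"
  assumes A: "A \<in> carrier_mat n n" and sym: "transpose_mat A = A" and n: "n > 0"
  shows "eigenvalue A (lambda_max A)"
    and "v \<in> carrier_vec n \<Longrightarrow> v \<bullet> (A *\<^sub>v v) \<le> lambda_max A * sqnorm v"
proof -
  obtain K where K: "K > 0" "\<And>v. v \<in> carrier_vec n \<Longrightarrow> sqnorm (A *\<^sub>v v) \<le> K * sqnorm v"
    using mult_mat_vec_bounded[OF A] by metis
  define R where "R = {v \<bullet> (A *\<^sub>v v) | v. v \<in> carrier_vec n \<and> sqnorm v = 1}"
  define m where "m = Sup R"
  have "sqnorm (unit_vec n 0) = 1"
    using n scalar_prod_left_unit[of "unit_vec n 0" n 0] by simp
  then have ne: "R \<noteq> {}" unfolding R_def by (auto intro!: exI[of _ "unit_vec n 0"])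
  have "bdd_above R"
  proof (rule bdd_aboveI[of _ "(1 + K) / 2"])
    fix x assume "x \<in> R"
    then obtain v where v: "v \<in> carrier_vec n" "sqnorm v = 1" "x = v \<bullet> (A *\<^sub>v v)"
      by (auto simp: R_def)
    have "x \<le> (sqnorm v + sqnorm (A *\<^sub>v v)) / 2"
      unfolding v(3) using A v by (intro scalar_prod_le_sqnorm[of _ n]) auto
    then show "x \<le> (1 + K) / 2" using K(2)[OF v(1)] v(2) by simp
  qed
  note R_upper = cSup_upper[OF _ this, folded m_def]
  have le: "v \<bullet> (A *\<^sub>v v) \<le> m * sqnorm v" if v: "v \<in> carrier_vec n" for v
  proof (cases "v = 0\<^sub>v n")
    case True
    with A v show ?thesis by simp
  next
    case False
    define s where "s = sqnorm v"
    have s: "s > 0" using sqnorm_pos[OF v False] by (simp add: s_def)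
    define u where "u = (1 / sqrt s) \<cdot>\<^sub>v v"
    have u: "u \<in> carrier_vec n" using v by (simp add: u_def)
    have Au: "A *\<^sub>v u = (1 / sqrt s) \<cdot>\<^sub>v (A *\<^sub>v v)"
      unfolding u_def by (rule mult_mat_vec[OF A v])
    have "sqnorm u = 1" using s by (simp add: u_def flip: s_def)
    then have "u \<bullet> (A *\<^sub>v u) \<le> m" using u by (intro R_upper) (auto simp: R_def)
    moreover have "u \<bullet> (A *\<^sub>v u) = (v \<bullet> (A *\<^sub>v v)) / s"
      unfolding Au using A v s by (simp add: u_def)
    ultimately show ?thesis using s by (simp add: field_simps s_def)
  qed
  \<comment> \<open>As a matrix, \<open>B\<close> is \<open>m\<close> times the identity minus
    \<open>A\<close>.\<close>
  define B where "B = - char_matrix A m"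
  have B: "B \<in> carrier_mat n n" using A by (simp add: B_def)
  have Bv: "B *\<^sub>v v = m \<cdot>\<^sub>v v - A *\<^sub>v v" if "v \<in> carrier_vec n" for v
    unfolding B_def using A that char_matrix_mult_vec[OF A that, of m]
    by (subst uminus_mult_mat_vec) (auto simp: carrier_matD[OF char_matrix_closed[OF A]])
  have form: "v \<bullet> (B *\<^sub>v v) = m * sqnorm v - v \<bullet> (A *\<^sub>v v)" if v: "v \<in> carrier_vec n" for v
    unfolding Bv[OF v] using A v by (simp add: scalar_prod_minus_distrib[of _ n])
  have symB: "transpose_mat B = B"
  proof (intro eq_matI)
    have "A $$ (i, j) = A $$ (j, i)" if "i < n" "j < n" for i j
      using sym A that by (metis carrier_matD index_transpose_mat(1))
    then show "transpose_mat B $$ (i, j) = B $$ (i, j)" if "i < dim_row B" "j < dim_col B" for i j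
      using that A B by (auto simp: B_def char_matrix_def)
  qed (use B in auto)
  have ev: "eigenvalue A m"
  proof (rule ccontr)
    assume "\<not> eigenvalue A m"
    then have "det (char_matrix A m) \<noteq> 0" by (simp add: eigenvalue_det[OF A])
    from det_non_zero_imp_unit[OF char_matrix_closed[OF A] this]
    obtain G where G: "G \<in> carrier_mat n n" "G * char_matrix A m = 1\<^sub>m n"
      by (auto simp: Units_def ring_mat_simps)
    obtain L where L: "L > 0" "\<And>v. v \<in> carrier_vec n \<Longrightarrow> sqnorm (G *\<^sub>v v) \<le> L * sqnorm v"
      using mult_mat_vec_bounded[OF G(1)] by metis
    obtain C where C: "C > 0" "\<And>v. v \<in> carrier_vec n \<Longrightarrow> sqnorm (B *\<^sub>v v) \<le> C * (v \<bullet> (B *\<^sub>v v))"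
      using psd_sqnorm_mult_le[OF B symB] le form by (metis diff_ge_0_iff_ge)
    \<comment> \<open>For a unit vector the inverse \<open>G\<close> yields
      \<open>1 \<le> L * sqnorm (B *\<^sub>v v)\<close>, and semidefiniteness bounds the right side
      by \<open>L * C * (m - x)\<close>. All Rayleigh quotients thus stay a fixed distance below
      their supremum.\<close>
    have "x \<le> m - 1 / (L * C)" if "x \<in> R" for x
    proof -
      obtain v where v: "v \<in> carrier_vec n" "sqnorm v = 1" "x = v \<bullet> (A *\<^sub>v v)"
        using \<open>x \<in> R\<close> by (auto simp: R_def)
      have cv: "char_matrix A m *\<^sub>v v \<in> carrier_vec n" using v A by (intro mult_mat_vec_carrier[of _ n n]) auto
      have "1 = sqnorm (G *\<^sub>v (char_matrix A m *\<^sub>v v))"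
        using G v char_matrix_closed[OF A, of m] by (simp flip: assoc_mult_mat_vec)
      also have "\<dots> \<le> L * sqnorm (char_matrix A m *\<^sub>v v)"
        by (rule L(2)[OF cv])
      also have "sqnorm (char_matrix A m *\<^sub>v v) = sqnorm (B *\<^sub>v v)"
        using A B v char_matrix_mult_vec[OF A v(1), of m]
        by (simp add: Bv sqnorm_eq_sum power2_commute)
      also have "L * \<dots> \<le> L * (C * (v \<bullet> (B *\<^sub>v v)))"
        using C(2)[OF v(1)] L(1) by (simp add: mult_left_mono)
      also have "\<dots> = L * C * (m - x)" using form[OF v(1)] v by simp
      finally show ?thesis using L C by (simp add: field_simps)
    qed
    then have "m \<le> m - 1 / (L * C)" unfolding m_def by (intro cSup_least[OF ne]) auto
    with mult_pos_pos[OF L(1) C(1)] show False by simp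
  qed
  have "lambda_max A = m"
    unfolding lambda_max_def
  proof (rule Max_eqI)
    show "finite (spectrum A)" by (rule card_finite_spectrum[OF A])
    show "m \<in> spectrum A" using ev by (simp add: spectrum_def)
    fix e assume "e \<in> spectrum A"
    then obtain v where "eigenvector A v e" by (auto simp: spectrum_def eigenvalue_def)
    then have v: "v \<in> carrier_vec n" "v \<noteq> 0\<^sub>v n" "A *\<^sub>v v = e \<cdot>\<^sub>v v"
      using A by (auto simp: eigenvector_def)
    have "e * sqnorm v \<le> m * sqnorm v" using le[OF v(1)] v by simp
    with sqnorm_pos[OF v(1,2)] show "e \<le> m" by simp
  qed
  with ev le show "eigenvalue A (lambda_max A)"
    and "v \<in> carrier_vec n \<Longrightarrow> v \<bullet> (A *\<^sub>v v) \<le> lambda_max A * sqnorm v" by auto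
qed

lemma lambda_max_le_iff:
  fixes A :: "real mat"
  assumes A: "A \<in> carrier_mat n n" and sym: "transpose_mat A = A" and n: "n > 0"
  shows "lambda_max A \<le> c \<longleftrightarrow> (\<forall>v\<in>carrier_vec n. v \<bullet> (A *\<^sub>v v) \<le> c * sqnorm v)"
proof
  assume "lambda_max A \<le> c"
  then show "\<forall>v\<in>carrier_vec n. v \<bullet> (A *\<^sub>v v) \<le> c * sqnorm v"
    using lambda_max_rayleigh(2)[OF assms] sqnorm_nonneg mult_right_mono by (metis order_trans)
next
  assume le: "\<forall>v\<in>carrier_vec n. v \<bullet> (A *\<^sub>v v) \<le> c * sqnorm v"
  obtain v where "eigenvector A v (lambda_max A)"
    using lambda_max_rayleigh(1)[OF assms] by (auto simp: eigenvalue_def)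
  then have v: "v \<in> carrier_vec n" "v \<noteq> 0\<^sub>v n" "A *\<^sub>v v = lambda_max A \<cdot>\<^sub>v v"
    using A by (auto simp: eigenvector_def)
  have "lambda_max A * sqnorm v \<le> c * sqnorm v" using bspec[OF le v(1)] v by simp
  with sqnorm_pos[OF v(1,2)] show "lambda_max A \<le> c" by simp
qed

section \<open>Diagonal entries and measurability of the largest eigenvalue\<close>

lemma scalar_prod_mult_mat_vec:
  fixes A :: "real mat"
  assumes "A \<in> carrier_mat n n" "v \<in> carrier_vec n"
  shows "v \<bullet> (A *\<^sub>v v) = (\<Sum>i<n. \<Sum>j<n. A $$ (i, j) * v $ i * v $ j)"
  using assms
  by (simp add: scalar_prod_def atLeast0LessThan sum_distrib_left mult_ac)

lemma diag_le_lambda_max: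
  fixes A :: "real mat"
  assumes A: "A \<in> carrier_mat n n" and sym: "transpose_mat A = A" and i: "i < n"
  shows "A $$ (i, i) \<le> lambda_max A"
proof -
  have "A $$ (i, i) = unit_vec n i \<bullet> (A *\<^sub>v unit_vec n i)"
    using A i by simp
  also have "\<dots> \<le> lambda_max A * sqnorm (unit_vec n i)"
    using A sym i by (intro lambda_max_rayleigh(2)[of _ n]) auto
  also have "sqnorm (unit_vec n i) = 1" using i by simp
  finally show ?thesis by simp
qed

text \<open>Both sides of the form inequality are continuous in the vector, so rational vectors
  suffice. Lists of rationals form a countable type, which makes the event
  \<open>lambda_max A \<le> c\<close> a countable intersection. A list shorter than \<open>n\<close>
  does no harm: \<open>q ! i\<close> still denotes some rational.\<close>

lemma lambda_max_le_iff_rat: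
  fixes A :: "real mat"
  assumes A: "A \<in> carrier_mat n n" and sym: "transpose_mat A = A" and n: "n > 0"
  shows "lambda_max A \<le> c \<longleftrightarrow>
    (\<forall>q :: rat list. (\<Sum>i<n. \<Sum>j<n. A $$ (i, j) * of_rat (q ! i) * of_rat (q ! j))
       \<le> c * (\<Sum>i<n. (of_rat (q ! i))\<^sup>2))"
    (is "_ \<longleftrightarrow> (\<forall>q. ?F q \<le> _)")
proof
  assume L: "lambda_max A \<le> c"
  show "\<forall>q. ?F q \<le> c * (\<Sum>i<n. (of_rat (q ! i))\<^sup>2)"
  proof
    fix q :: "rat list"
    have v: "vec n (\<lambda>i. of_rat (q ! i)) \<in> carrier_vec n" by simp
    from L[unfolded lambda_max_le_iff[OF assms], rule_format, OF v]
    show "?F q \<le> c * (\<Sum>i<n. (of_rat (q ! i))\<^sup>2)"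
      by (simp add: scalar_prod_mult_mat_vec[OF A v] sqnorm_eq_sum cong: sum.cong_simp)
  qed
next
  assume R: "\<forall>q. ?F q \<le> c * (\<Sum>i<n. (of_rat (q ! i))\<^sup>2)"
  show "lambda_max A \<le> c"
    unfolding lambda_max_le_iff[OF assms]
  proof
    fix v :: "real vec" assume v: "v \<in> carrier_vec n"
    have "\<exists>r :: nat \<Rightarrow> rat. (\<lambda>k. of_rat (r k)) \<longlonglongrightarrow> x" for x :: real
    proof -
      have "\<exists>q :: rat. x - 1 / real (Suc k) < of_rat q \<and> of_rat q < x" for k
        using of_rat_dense[of "x - 1 / real (Suc k)" x] by simp
      then obtain r :: "nat \<Rightarrow> rat"
        where r: "\<And>k. x - 1 / real (Suc k) < of_rat (r k) \<and> of_rat (r k) < x" by metis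
      have "(\<lambda>k. of_rat (r k)) \<longlonglongrightarrow> x"
      proof (rule tendsto_sandwich)
        show "(\<lambda>k. x - 1 / real (Suc k)) \<longlonglongrightarrow> x"
          using tendsto_diff[OF tendsto_const LIMSEQ_inverse_real_of_nat]
          by (simp add: inverse_eq_divide)
        show "(\<lambda>k. x) \<longlonglongrightarrow> x" by simp
      qed (use r in \<open>auto intro!: always_eventually less_imp_le\<close>)
      then show ?thesis by blast
    qed
    then obtain r :: "real \<Rightarrow> nat \<Rightarrow> rat" where r: "\<And>x. (\<lambda>k. of_rat (r x k)) \<longlonglongrightarrow> x" by metis
    define q where "q k = map (\<lambda>i. r (v $ i) k) [0..<n]" for k
    have q: "q k ! i = r (v $ i) k" if "i < n" for i k using that by (simp add: q_def)
    have "(\<lambda>k. \<Sum>i<n. \<Sum>j<n. A $$ (i, j) * of_rat (q k ! i) * of_rat (q k ! j))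
        \<longlonglongrightarrow> (\<Sum>i<n. \<Sum>j<n. A $$ (i, j) * v $ i * v $ j)"
      by (intro tendsto_sum tendsto_mult tendsto_const) (auto simp: q r)
    moreover have "(\<lambda>k. c * (\<Sum>i<n. (of_rat (q k ! i))\<^sup>2)) \<longlonglongrightarrow> c * (\<Sum>i<n. (v $ i)\<^sup>2)"
      by (intro tendsto_sum tendsto_mult tendsto_const tendsto_power) (auto simp: q r)
    ultimately have "(\<Sum>i<n. \<Sum>j<n. A $$ (i, j) * v $ i * v $ j) \<le> c * (\<Sum>i<n. (v $ i)\<^sup>2)"
      using R by (intro LIMSEQ_le) auto
    then show "v \<bullet> (A *\<^sub>v v) \<le> c * sqnorm v"
      using v by (simp add: scalar_prod_mult_mat_vec[OF A v] sqnorm_eq_sum)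
  qed
qed

lemma borel_measurable_lambda_max:
  fixes A :: "'a \<Rightarrow> real mat"
  assumes A: "\<And>\<omega>. A \<omega> \<in> carrier_mat n n" and sym: "\<And>\<omega>. transpose_mat (A \<omega>) = A \<omega>"
    and meas: "\<And>i j. i < n \<Longrightarrow> j < n \<Longrightarrow> (\<lambda>\<omega>. A \<omega> $$ (i, j)) \<in> borel_measurable M"
  shows "(\<lambda>\<omega>. lambda_max (A \<omega>)) \<in> borel_measurable M"
proof (cases "n = 0")
  case True
  \<comment> \<open>The spectrum is empty here and \<open>Max\<close> has no specified value, but
    that value does not depend on \<open>\<omega>\<close>.\<close>
  then have "A \<omega> = 0\<^sub>m 0 0" for \<omega> using A[of \<omega>] by (intro eq_matI) auto
  then show ?thesis by simp
next
  case False
  then have n: "n > 0" by simp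
  have "(\<lambda>\<omega>. \<Sum>i<n. \<Sum>j<n. A \<omega> $$ (i, j) * of_rat (q ! i) * of_rat (q ! j))
      \<in> borel_measurable M" for q :: "rat list"
    by (intro borel_measurable_sum borel_measurable_times meas) auto
  then have [measurable]: "Measurable.pred M (\<lambda>\<omega>. (\<Sum>i<n. \<Sum>j<n. A \<omega> $$ (i, j) * of_rat (q ! i) * of_rat (q ! j))
       \<le> c * (\<Sum>i<n. (of_rat (q ! i))\<^sup>2))" for q :: "rat list" and c :: real
    by measurable
  have "{\<omega> \<in> space M. lambda_max (A \<omega>) \<le> c} \<in> sets M" for c
    unfolding lambda_max_le_iff_rat[OF A sym n] by measurable
  then show ?thesis by (simp add: borel_measurable_iff_le)
qed

section \<open>Periodic Jacobi forms\<close>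

lemma sum_shift_mod:
  fixes f :: "nat \<Rightarrow> 'b::comm_monoid_add"
  shows "(\<Sum>i<N. f ((i + j) mod N)) = (\<Sum>i<N. f i)"
proof (induction j arbitrary: f)
  case 0
  show ?case by (intro sum.cong) auto
next
  case (Suc j)
  have "(\<Sum>i<N. f ((i + Suc j) mod N)) = (\<Sum>i<N. f (Suc ((i + j) mod N) mod N))"
    by (simp add: mod_Suc_eq)
  also have "\<dots> = (\<Sum>i<N. f (Suc i mod N))" by (rule Suc.IH)
  also have "\<dots> = (\<Sum>i<N. f i)"
  proof (cases N)
    case (Suc m)
    have "(\<Sum>i<Suc m. f (Suc i mod Suc m)) = (\<Sum>i<m. f (Suc i)) + f 0"
      by (simp add: sum.lessThan_Suc)
    also have "\<dots> = (\<Sum>i<Suc m. f i)" by (simp only: sum.lessThan_Suc_shift add.commute)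
    finally show ?thesis using Suc by simp
  qed simp
  finally show ?case .
qed

text \<open>Expanding the right side gives twice the product of every pair, of which the left side
  keeps only the neighbouring pairs. With \<open>x j = (v j)\<^sup>2\<close> it bounds the
  tridiagonal part of the Hilbert-Schmidt norm of the rank-one matrix built from
  \<open>v\<close>.\<close>

lemma sum_path_squares_le:
  fixes x :: "nat \<Rightarrow> real"
  assumes "\<And>j. 0 \<le> x j"
  shows "(\<Sum>j<Suc m. (x j)\<^sup>2) + 2 * (\<Sum>j<m. x j * x (Suc j)) \<le> (\<Sum>j<Suc m. x j)\<^sup>2"
proof (induction m)
  case (Suc m)
  have "x m \<le> (\<Sum>j<Suc m. x j)" using assms by (simp add: sum_nonneg)
  then have "2 * (x m * x (Suc m)) \<le> 2 * ((\<Sum>j<Suc m. x j) * x (Suc m))"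
    using assms by (intro mult_left_mono mult_right_mono) auto
  with Suc show ?case
    by (simp add: sum.lessThan_Suc[of _ "Suc m"] power2_sum) (simp add: algebra_simps)
qed simp

text \<open>The operator norm of a Jacobi matrix is at most its Hilbert--Schmidt norm.\<close>

lemma window_form_le:
  fixes a b v :: "nat \<Rightarrow> real"
  assumes s: "s > 0" and le: "(\<Sum>j<Suc m. (a j)\<^sup>2 + 2 * (b j)\<^sup>2) \<le> s\<^sup>2"
  shows "(\<Sum>j<Suc m. a j * (v j)\<^sup>2) + 2 * (\<Sum>j<m. b j * v j * v (Suc j)) \<le> s * (\<Sum>j<Suc m. (v j)\<^sup>2)"
proof (cases "(\<Sum>j<Suc m. (v j)\<^sup>2) = 0")
  case True
  then have "\<And>j. j < Suc m \<Longrightarrow> v j = 0"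
    by (subst (asm) sum_nonneg_eq_0_iff) auto
  then show ?thesis by simp
next
  case False
  define T where "T = (\<Sum>j<Suc m. (v j)\<^sup>2)"
  have T: "T > 0" using False sum_nonneg[of "{..<Suc m}" "\<lambda>j. (v j)\<^sup>2"] by (simp add: T_def)
  \<comment> \<open>The weight of the inequality between arithmetic and geometric means that
    replaces Cauchy-Schwarz: \<open>c / 2 * s\<^sup>2 + T\<^sup>2 / (2 * c)\<close> is smallest at
    \<open>c = T / s\<close>, with value \<open>s * T\<close>.\<close>
  define c where "c = T / s"
  have c: "c > 0" using T s by (simp add: c_def)
  have am_gm: "x * y \<le> (c * x\<^sup>2 + y\<^sup>2 / c) / 2" for x y :: real
    using c zero_le_power2[of "c * x - y"] by (simp add: field_simps power2_eq_square)
  have split_sum: "(\<Sum>j<k. (c * f j + g j / c) / 2) = c / 2 * (\<Sum>j<k. f j) + 1 / (2 * c) * (\<Sum>j<k. g j)"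
    for f g :: "nat \<Rightarrow> real" and k
    unfolding sum_distrib_left sum.distrib[symmetric]
    by (intro sum.cong refl) (use c in \<open>auto simp: field_simps\<close>)
  have "(\<Sum>j<Suc m. a j * (v j)\<^sup>2) + 2 * (\<Sum>j<m. b j * v j * v (Suc j))
      \<le> (\<Sum>j<Suc m. (c * (a j)\<^sup>2 + ((v j)\<^sup>2)\<^sup>2 / c) / 2)
        + 2 * (\<Sum>j<m. (c * (b j)\<^sup>2 + (v j * v (Suc j))\<^sup>2 / c) / 2)"
    by (intro add_mono mult_left_mono sum_mono order.refl) (simp_all only: mult.assoc am_gm)
  also have "\<dots> = c / 2 * ((\<Sum>j<Suc m. (a j)\<^sup>2) + 2 * (\<Sum>j<m. (b j)\<^sup>2))
     + 1 / (2 * c) * ((\<Sum>j<Suc m. ((v j)\<^sup>2)\<^sup>2) + 2 * (\<Sum>j<m. (v j)\<^sup>2 * (v (Suc j))\<^sup>2))"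
    unfolding split_sum power_mult_distrib by (simp only: distrib_left mult.left_commute ac_simps)
  also have "\<dots> \<le> c / 2 * s\<^sup>2 + 1 / (2 * c) * T\<^sup>2"
  proof (intro add_mono mult_left_mono)
    \<comment> \<open>The last \<open>b m\<close> belongs to an edge leaving the window; it sits in
      the hypothesis only to give all sites the same summand.\<close>
    have "(\<Sum>j<m. (b j)\<^sup>2) \<le> (\<Sum>j<Suc m. (b j)\<^sup>2)" by simp
    then show "(\<Sum>j<Suc m. (a j)\<^sup>2) + 2 * (\<Sum>j<m. (b j)\<^sup>2) \<le> s\<^sup>2"
      using le unfolding sum.distrib sum_distrib_left[symmetric] by linarith
    show "(\<Sum>j<Suc m. ((v j)\<^sup>2)\<^sup>2) + 2 * (\<Sum>j<m. (v j)\<^sup>2 * (v (Suc j))\<^sup>2) \<le> T\<^sup>2"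
      unfolding T_def by (rule sum_path_squares_le) simp
  qed (use c in auto)
  also have "\<dots> = s * T" using s T by (simp add: c_def field_simps power2_eq_square)
  finally show ?thesis by (simp add: T_def)
qed

text \<open>Averaging over all cyclic windows of \<open>m + 1\<close> consecutive sites, each site is seen by
  \<open>m + 1\<close> windows and each edge by \<open>m\<close> of them, so only a fraction \<open>1 / (m + 1)\<close> of the
  off-diagonal part is not accounted for by the windows.\<close>

lemma cyclic_form_le:
  fixes a b v :: "nat \<Rightarrow> real"
  assumes s: "s > 0"
    and le: "\<And>i. i < N \<Longrightarrow> (\<Sum>j<Suc m. (a ((i + j) mod N))\<^sup>2 + 2 * (b ((i + j) mod N))\<^sup>2) \<le> s\<^sup>2"
  shows "(\<Sum>i<N. a i * (v i)\<^sup>2) + 2 * (\<Sum>i<N. b i * v i * v (Suc i mod N))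
    \<le> (1 + 2 / real (Suc m)) * s * (\<Sum>i<N. (v i)\<^sup>2)"
proof -
  define Q where "Q = (\<Sum>i<N. a i * (v i)\<^sup>2)"
  define E where "E = (\<Sum>i<N. b i * v i * v (Suc i mod N))"
  define V where "V = (\<Sum>i<N. (v i)\<^sup>2)"
  have average: "(\<Sum>i<N. \<Sum>j<k. f ((i + j) mod N)) = real k * (\<Sum>i<N. f i)" for f :: "nat \<Rightarrow> real" and k
    by (subst sum.swap) (simp add: sum_shift_mod)
  have Q: "real (Suc m) * Q = (\<Sum>i<N. \<Sum>j<Suc m. a ((i + j) mod N) * (v ((i + j) mod N))\<^sup>2)"
    unfolding Q_def by (rule average[symmetric])
  have E: "real m * E = (\<Sum>i<N. \<Sum>j<m. b ((i + j) mod N) * v ((i + j) mod N) * v (Suc ((i + j) mod N) mod N))"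
    unfolding E_def by (rule average[symmetric])
  have "real (Suc m) * Q + 2 * (real m * E) =
    (\<Sum>i<N. (\<Sum>j<Suc m. a ((i + j) mod N) * (v ((i + j) mod N))\<^sup>2)
      + 2 * (\<Sum>j<m. b ((i + j) mod N) * v ((i + j) mod N) * v ((i + Suc j) mod N)))"
    unfolding Q E sum.distrib by (simp only: sum_distrib_left mod_Suc_eq add_Suc_right)
  also have "\<dots> \<le> (\<Sum>i<N. s * (\<Sum>j<Suc m. (v ((i + j) mod N))\<^sup>2))"
    using le by (intro sum_mono window_form_le[OF s]) auto
  also have "\<dots> = s * (real (Suc m) * V)"
    unfolding V_def average[symmetric] by (rule sum_distrib_left[symmetric])
  finally have windows: "real (Suc m) * Q + 2 * (real m * E) \<le> s * (real (Suc m) * V)" .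
  \<comment> \<open>The windows count \<open>2 * E\<close> once too few. The crude bound
    \<open>\<bar>b i\<bar> \<le> s\<close>, read off from any window containing \<open>i\<close>,
    pays for the missing copy and produces the \<open>2 / real (Suc m)\<close>.\<close>
  have "E \<le> (\<Sum>i<N. s * (((v i)\<^sup>2 + (v (Suc i mod N))\<^sup>2) / 2))"
    unfolding E_def
  proof (rule sum_mono)
    fix i assume i: "i \<in> {..<N}"
    have "(b i)\<^sup>2 \<le> (a i)\<^sup>2 + 2 * (b i)\<^sup>2" by simp
    also have "\<dots> \<le> (\<Sum>j<Suc m. (a ((i + j) mod N))\<^sup>2 + 2 * (b ((i + j) mod N))\<^sup>2)"
      using i member_le_sum[of 0 "{..<Suc m}" "\<lambda>j. (a ((i + j) mod N))\<^sup>2 + 2 * (b ((i + j) mod N))\<^sup>2"]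
      by simp
    also have "\<dots> \<le> s\<^sup>2" using i le by simp
    finally have "\<bar>b i\<bar> \<le> s" using s abs_le_square_iff[of "b i" s] by simp
    have "b i * v i * v (Suc i mod N) \<le> \<bar>b i\<bar> * \<bar>v i * v (Suc i mod N)\<bar>"
      by (metis abs_ge_self abs_mult mult.assoc)
    also have "\<dots> \<le> s * \<bar>v i * v (Suc i mod N)\<bar>"
      using \<open>\<bar>b i\<bar> \<le> s\<close> by (intro mult_right_mono) auto
    also have "\<bar>v i * v (Suc i mod N)\<bar> \<le> ((v i)\<^sup>2 + (v (Suc i mod N))\<^sup>2) / 2"
      using sum_squares_bound[of "\<bar>v i\<bar>" "\<bar>v (Suc i mod N)\<bar>"] by (simp add: abs_mult)
    finally show "b i * v i * v (Suc i mod N) \<le> s * (((v i)\<^sup>2 + (v (Suc i mod N))\<^sup>2) / 2)"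
      using s by simp
  qed
  also have "\<dots> = s * ((V + (\<Sum>i<N. (v ((i + 1) mod N))\<^sup>2)) / 2)"
    by (simp only: V_def sum.distrib sum_distrib_left[symmetric] sum_divide_distrib[symmetric] Suc_eq_plus1)
  also have "\<dots> = s * V"
    using sum_shift_mod[of "\<lambda>i. (v i)\<^sup>2" 1 N] by (simp add: V_def)
  finally have "real (Suc m) * (Q + 2 * E) \<le> s * (real (Suc m) * V) + 2 * (s * V)"
    using windows by (simp add: algebra_simps)
  then show ?thesis
    unfolding Q_def[symmetric] E_def[symmetric] V_def[symmetric] by (simp add: field_simps)
qed

section \<open>The two matrix models as cyclic forms\<close>

lemma tridiag_carrier: "tridiag N a b \<in> carrier_mat N N"
  by (simp add: tridiag_def)

lemma tridiag_per_carrier: "tridiag_per N a b \<in> carrier_mat N N"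
  by (simp add: tridiag_per_def)

lemma transpose_tridiag: "transpose_mat (tridiag N a b) = tridiag N a b"
  by (intro eq_matI) (auto simp: tridiag_def)

lemma transpose_tridiag_per: "transpose_mat (tridiag_per N a b) = tridiag_per N a b"
  by (intro eq_matI) (auto simp: tridiag_per_def tridiag_def)

text \<open>Reduces the plain model to the periodic one. For \<open>N = 1\<close> and
  \<open>N = 2\<close> the corners would overwrite entries of the tridiagonal part.\<close>

lemma tridiag_eq_tridiag_per:
  assumes "N \<ge> 3"
  shows "tridiag N a b = tridiag_per N a (b(N := 0))"
  using assms by (intro eq_matI) (auto simp: tridiag_per_def tridiag_def)

text \<open>For \<open>N \<ge> 3\<close> a site, its successor and its predecessor on the cycle are
  distinct, so at most one of the three conditions in \<open>entry\<close> holds. The corner is the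
  edge from the last site back to the first, which is why \<open>Suc i mod N\<close> covers
  it.\<close>

lemma tridiag_per_form:
  assumes N: "N \<ge> 3" and v: "v \<in> carrier_vec N"
  shows "v \<bullet> (tridiag_per N a b *\<^sub>v v) =
    (\<Sum>i<N. a (Suc i) * (v $ i)\<^sup>2) + 2 * (\<Sum>i<N. b (Suc i) * v $ i * v $ (Suc i mod N))"
proof -
  have entry: "tridiag_per N a b $$ (i, j) =
      (if j = i then a (Suc i) else 0) + (if j = Suc i mod N then b (Suc i) else 0)
      + (if i = Suc j mod N then b (Suc j) else 0)" if "i < N" "j < N" for i j
  proof -
    have Suc_mod: "Suc k mod N = (if Suc k = N then 0 else Suc k)" if "k < N" for k
      using that by auto
    have "tridiag_per N a b $$ (i, j) =
        (if i = 0 \<and> j = N - 1 \<or> i = N - 1 \<and> j = 0 then b N else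
         if i = j then a (Suc i) else if j = Suc i then b (Suc i) else if i = Suc j then b (Suc j) else 0)"
      using that by (simp add: tridiag_per_def tridiag_def)
    also have "\<dots> = (if j = i then a (Suc i) else 0) + (if j = (if Suc i = N then 0 else Suc i) then b (Suc i) else 0)
        + (if i = (if Suc j = N then 0 else Suc j) then b (Suc j) else 0)"
    proof -
      obtain M where M: "N = Suc (Suc (Suc M))" using N by (auto simp: numeral_3_eq_3 le_iff_add)
      consider "i = j" | "j = Suc i" | "i = Suc j" | "i = Suc (Suc M)" "j = 0" | "i = 0" "j = Suc (Suc M)"
        | "i \<noteq> j" "j \<noteq> Suc i" "i \<noteq> Suc j" "\<not> (i = Suc (Suc M) \<and> j = 0)" "\<not> (i = 0 \<and> j = Suc (Suc M))"
        by blast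
      then show ?thesis
      proof cases
        case 6
        then have "j \<noteq> (if Suc i = N then 0 else Suc i)" "i \<noteq> (if Suc j = N then 0 else Suc j)"
          unfolding M by (auto split: if_split)
        then show ?thesis using 6 by (simp only: M if_False diff_Suc_1 simp_thms eq_commute[of j i])
      qed (use that[unfolded M] in \<open>simp_all add: M\<close>)
    qed
    finally show ?thesis
      unfolding Suc_mod[OF that(1)] Suc_mod[OF that(2)] .
  qed
  have "v \<bullet> (tridiag_per N a b *\<^sub>v v) =
      (\<Sum>i<N. \<Sum>j<N. (if j = i then a (Suc i) * v $ i * v $ j else 0)
        + (if j = Suc i mod N then b (Suc i) * v $ i * v $ j else 0)
        + (if i = Suc j mod N then b (Suc j) * v $ i * v $ j else 0))"
    unfolding scalar_prod_mult_mat_vec[OF tridiag_per_carrier v]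
  proof (intro sum.cong refl)
    fix i j assume "i \<in> {..<N}" "j \<in> {..<N}"
    then show "tridiag_per N a b $$ (i, j) * v $ i * v $ j =
       (if j = i then a (Suc i) * v $ i * v $ j else 0)
        + (if j = Suc i mod N then b (Suc i) * v $ i * v $ j else 0)
        + (if i = Suc j mod N then b (Suc j) * v $ i * v $ j else 0)"
      by (simp only: entry lessThan_iff distrib_right if_distribR if_distrib[of "\<lambda>x. x * _"] mult_zero_left)
  qed
  also have "\<dots> = (\<Sum>i<N. a (Suc i) * v $ i * v $ i)
      + (\<Sum>i<N. b (Suc i) * v $ i * v $ (Suc i mod N))
      + (\<Sum>i<N. \<Sum>j<N. if i = Suc j mod N then b (Suc j) * v $ i * v $ j else 0)"
    using N by (simp add: sum.distrib)
  also have "(\<Sum>i<N. \<Sum>j<N. if i = Suc j mod N then b (Suc j) * v $ i * v $ j else 0)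
      = (\<Sum>j<N. b (Suc j) * v $ (Suc j mod N) * v $ j)"
    using N by (subst sum.swap) simp
  also have "\<dots> = (\<Sum>i<N. b (Suc i) * v $ i * v $ (Suc i mod N))"
    by (simp add: mult_ac)
  finally show ?thesis by (simp add: power2_eq_square mult.assoc)
qed

lemma lambda_max_tridiag_per_le:
  assumes N: "N \<ge> 3" and s: "s > 0"
    and le: "\<And>i. i < N \<Longrightarrow>
      (\<Sum>j<Suc m. (a (Suc ((i + j) mod N)))\<^sup>2 + 2 * (b (Suc ((i + j) mod N)))\<^sup>2) \<le> s\<^sup>2"
  shows "lambda_max (tridiag_per N a b) \<le> (1 + 2 / real (Suc m)) * s"
proof -
  have "v \<bullet> (tridiag_per N a b *\<^sub>v v) \<le> (1 + 2 / real (Suc m)) * s * sqnorm v"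
    if v: "v \<in> carrier_vec N" for v
    using cyclic_form_le[OF s le, of "\<lambda>i. v $ i"] v
    by (simp add: tridiag_per_form[OF N v] sqnorm_eq_sum)
  with N show ?thesis
    by (subst lambda_max_le_iff[OF tridiag_per_carrier transpose_tridiag_per]) auto
qed

lemma lambda_max_tridiag_le:
  assumes N: "N \<ge> 3" and s: "s > 0"
    and le: "\<And>i. i < N \<Longrightarrow>
      (\<Sum>j<Suc m. (a (Suc ((i + j) mod N)))\<^sup>2 + 2 * (b (Suc ((i + j) mod N)))\<^sup>2) \<le> s\<^sup>2"
  shows "lambda_max (tridiag N a b) \<le> (1 + 2 / real (Suc m)) * s"
  unfolding tridiag_eq_tridiag_per[OF N]
proof (rule lambda_max_tridiag_per_le[OF N s])
  fix i assume "i < N"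
  have "(\<Sum>j<Suc m. (a (Suc ((i + j) mod N)))\<^sup>2 + 2 * ((b(N := 0)) (Suc ((i + j) mod N)))\<^sup>2)
     \<le> (\<Sum>j<Suc m. (a (Suc ((i + j) mod N)))\<^sup>2 + 2 * (b (Suc ((i + j) mod N)))\<^sup>2)"
    by (intro sum_mono) auto
  also have "\<dots> \<le> s\<^sup>2" using le[OF \<open>i < N\<close>] .
  finally show "(\<Sum>j<Suc m. (a (Suc ((i + j) mod N)))\<^sup>2 + 2 * ((b(N := 0)) (Suc ((i + j) mod N)))\<^sup>2) \<le> s\<^sup>2" .
qed

lemma le_lambda_max_tridiag:
  assumes "i < N"
  shows "a (Suc i) \<le> lambda_max (tridiag N a b)"
  using diag_le_lambda_max[OF tridiag_carrier transpose_tridiag assms, of a b] assms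
  by (simp add: tridiag_def)

lemma le_lambda_max_tridiag_per:
  assumes "i < N" "N \<ge> 3"
  shows "a (Suc i) \<le> lambda_max (tridiag_per N a b)"
proof -
  have "tridiag_per N a b $$ (i, i) = a (Suc i)"
    using assms by (auto simp: tridiag_per_def tridiag_def)
  then show ?thesis
    using diag_le_lambda_max[OF tridiag_per_carrier transpose_tridiag_per assms(1), of a b] by simp
qed

section \<open>Gaussian tails\<close>

lemma elog_le_ereal_iff: "elog p \<le> ereal c \<longleftrightarrow> p \<le> exp c"
proof (cases "p > 0")
  case True
  then have "ln p \<le> c \<longleftrightarrow> p \<le> exp c" by (metis exp_le_cancel_iff exp_ln)
  with True show ?thesis by (simp add: elog_def)
next
  case False
  then have "p \<le> exp c" using exp_gt_zero[of c] by linarith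
  with False show ?thesis by (simp add: elog_def)
qed

lemma ereal_le_elog_iff: "ereal c \<le> elog p \<longleftrightarrow> exp c \<le> p"
proof (cases "p > 0")
  case True
  then show ?thesis by (simp add: elog_def ln_ge_iff)
next
  case False
  then have "\<not> exp c \<le> p" using exp_gt_zero[of c] by linarith
  with False show ?thesis by (simp add: elog_def)
qed

text \<open>Beyond a threshold common to the family, the remainder is at most
  \<open>\<epsilon> * x\<^sup>2 / 2\<close> and only changes the constant in the exponent. Kept are
  the upper bound for the two-sided tail, for the moments, and the lower bound for the one-sided
  tail, for the maximum of the diagonal.\<close>

lemma uniform_gaussian_tail_bounds:
  assumes ugt: "uniform_gaussian_tail I M X" and e: "\<epsilon> > 0"
  obtains x0 where "\<And>x i. x \<ge> x0 \<Longrightarrow> i \<in> I \<Longrightarrow>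
      measure (M i) {\<omega> \<in> space (M i). \<bar>X i \<omega>\<bar> > x} \<le> exp (- ((1 - \<epsilon>) * x\<^sup>2 / 2))"
    and "\<And>x i. x \<ge> x0 \<Longrightarrow> i \<in> I \<Longrightarrow>
      exp (- ((1 + \<epsilon>) * x\<^sup>2 / 2)) \<le> measure (M i) {\<omega> \<in> space (M i). X i \<omega> > x}"
proof -
  have aux: "exp (- (y + r)) \<le> p \<and> p \<le> exp (- (y - r))"
    if "\<bar>- elog p - ereal y\<bar> \<le> ereal r" for p y r :: real
  proof -
    \<comment> \<open>A null probability would make \<open>- elog p\<close> infinite, against the
      real bound \<open>r\<close>.\<close>
    have p: "p > 0" using that by (cases "p > 0") (auto simp: elog_def)
    with that have "\<bar>- ln p - y\<bar> \<le> r" by (simp add: elog_def)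
    then have "- (y + r) \<le> ln p" "ln p \<le> - (y - r)" by linarith+
    with p show ?thesis by (metis exp_le_cancel_iff exp_ln)
  qed
  obtain r where r: "r \<in> o[at_top](\<lambda>x. x\<^sup>2)"
    and ev: "\<forall>\<^sub>F x in at_top. \<forall>i\<in>I.
        \<bar>- elog (measure (M i) {\<omega> \<in> space (M i). \<bar>X i \<omega>\<bar> > x}) - ereal (x\<^sup>2 / 2)\<bar> \<le> ereal (r x) \<and>
        \<bar>- elog (measure (M i) {\<omega> \<in> space (M i). X i \<omega> > x}) - ereal (x\<^sup>2 / 2)\<bar> \<le> ereal (r x)"
    using ugt by (auto simp: uniform_gaussian_tail_def)
  have "\<forall>\<^sub>F x in at_top. norm (r x) \<le> \<epsilon> / 2 * norm (x\<^sup>2)"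
    using landau_o.smallD[OF r, of "\<epsilon> / 2"] e by simp
  with ev have "\<forall>\<^sub>F x in at_top. \<forall>i\<in>I.
      measure (M i) {\<omega> \<in> space (M i). \<bar>X i \<omega>\<bar> > x} \<le> exp (- ((1 - \<epsilon>) * x\<^sup>2 / 2)) \<and>
      exp (- ((1 + \<epsilon>) * x\<^sup>2 / 2)) \<le> measure (M i) {\<omega> \<in> space (M i). X i \<omega> > x}"
  proof eventually_elim
    case (elim x)
    have r: "r x \<le> \<epsilon> / 2 * x\<^sup>2" using elim(2) by simp
    have "- (x\<^sup>2 / 2 - r x) \<le> - ((1 - \<epsilon>) * x\<^sup>2 / 2)" "- ((1 + \<epsilon>) * x\<^sup>2 / 2) \<le> - (x\<^sup>2 / 2 + r x)"
      using r by (simp_all add: algebra_simps add_divide_distrib diff_divide_distrib)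
    then have "exp (- (x\<^sup>2 / 2 - r x)) \<le> exp (- ((1 - \<epsilon>) * x\<^sup>2 / 2))"
      "exp (- ((1 + \<epsilon>) * x\<^sup>2 / 2)) \<le> exp (- (x\<^sup>2 / 2 + r x))"
      unfolding exp_le_cancel_iff by blast+
    with elim(1) show ?case using aux by (meson order_trans)
  qed
  then obtain x0 where "\<And>x. x \<ge> x0 \<Longrightarrow> \<forall>i\<in>I.
      measure (M i) {\<omega> \<in> space (M i). \<bar>X i \<omega>\<bar> > x} \<le> exp (- ((1 - \<epsilon>) * x\<^sup>2 / 2)) \<and>
      exp (- ((1 + \<epsilon>) * x\<^sup>2 / 2)) \<le> measure (M i) {\<omega> \<in> space (M i). X i \<omega> > x}"
    unfolding eventually_at_top_linorder by blast
  with that show ?thesis by blast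
qed

section \<open>Exponential moments and products of independent variables\<close>

text \<open>Cut into unit layers,
  \<open>exp Z \<le> 1 + (\<Sum>n. exp (n + 1) * indicator {Z > n})\<close> for
  \<open>Z = \<theta> * X\<^sup>2 / 2\<close>, and \<open>Z > n\<close> has probability of order
  \<open>exp (- \<rho> * n)\<close> with \<open>\<rho> = \<eta> / \<theta> > 1\<close>, so a
  geometric series remains. \<open>C\<close> is obtained before \<open>M\<close> and
  \<open>X\<close> are fixed: one constant serves all entries and all \<open>N\<close>.\<close>

lemma exp_square_moment_bound:
  fixes \<eta> \<theta> x0 :: real
  assumes \<theta>: "0 < \<theta>" "\<theta> < \<eta>"
  obtains C where "C \<ge> 1"
    "\<And>(M :: 'a measure) X. prob_space M \<Longrightarrow> X \<in> borel_measurable M \<Longrightarrow>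
      (\<And>x. x \<ge> x0 \<Longrightarrow> measure M {\<omega> \<in> space M. \<bar>X \<omega>\<bar> > x} \<le> exp (- (\<eta> * x\<^sup>2 / 2))) \<Longrightarrow>
      (\<integral>\<^sup>+\<omega>. ennreal (exp (\<theta> * (X \<omega>)\<^sup>2 / 2)) \<partial>M) \<le> ennreal C"
proof -
  define \<rho> where "\<rho> = \<eta> / \<theta>"
  have \<rho>: "\<rho> > 1" using \<theta> by (simp add: \<rho>_def)
  \<comment> \<open>Covers the layers below the threshold \<open>x0\<close>, where no tail bound is
    available: there \<open>D * exp (- (\<rho> * real n))\<close> is at least 1.\<close>
  define D where "D = exp (\<rho> * (\<theta> * x0\<^sup>2 / 2))"
  have D: "D \<ge> 1" using \<theta> \<rho> by (simp add: D_def)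
  define g where "g n = exp (real n + 1) * (D * exp (- (\<rho> * real n)))" for n :: nat
  have g_eq: "g n = exp 1 * D * exp (1 - \<rho>) ^ n" for n
  proof -
    have "exp (real n + 1) * exp (- (\<rho> * real n)) = exp 1 * exp (1 - \<rho>) ^ n"
      unfolding exp_of_nat_mult[symmetric] mult_exp_exp by (simp add: algebra_simps)
    then show ?thesis by (simp add: g_def mult_ac)
  qed
  have summable: "summable g"
    unfolding g_eq using \<rho> by (intro summable_mult summable_geometric) simp
  have g0: "g n \<ge> 0" for n using D by (simp add: g_def)
  define C where "C = 1 + suminf g"
  show ?thesis
  proof
    show "C \<ge> 1" using suminf_nonneg[OF summable g0] by (simp add: C_def)
    fix M :: "'a measure" and X
    assume "prob_space M" and X [measurable]: "X \<in> borel_measurable M"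
      and tail: "\<And>x. x \<ge> x0 \<Longrightarrow> measure M {\<omega> \<in> space M. \<bar>X \<omega>\<bar> > x} \<le> exp (- (\<eta> * x\<^sup>2 / 2))"
    interpret prob_space M by fact
    define Z where "Z \<omega> = \<theta> * (X \<omega>)\<^sup>2 / 2" for \<omega>
    have [measurable]: "Z \<in> borel_measurable M" unfolding Z_def by measurable
    define A where "A n = {\<omega> \<in> space M. Z \<omega> > real n}" for n :: nat
    have [measurable]: "A n \<in> sets M" for n unfolding A_def by measurable
    have prob_A: "prob (A n) \<le> D * exp (- (\<rho> * real n))" for n
    proof (cases "sqrt (2 * real n / \<theta>) \<ge> x0")
      case True
      have "A n = {\<omega> \<in> space M. \<bar>X \<omega>\<bar> > sqrt (2 * real n / \<theta>)}"
      proof -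
        have "Z \<omega> > real n \<longleftrightarrow> \<bar>X \<omega>\<bar> > sqrt (2 * real n / \<theta>)" for \<omega>
        proof -
          have "Z \<omega> > real n \<longleftrightarrow> 2 * real n / \<theta> < (X \<omega>)\<^sup>2"
            using \<theta> by (simp add: Z_def field_simps)
          also have "\<dots> \<longleftrightarrow> sqrt (2 * real n / \<theta>) < sqrt ((X \<omega>)\<^sup>2)" by (rule real_sqrt_less_iff[symmetric])
          finally show ?thesis by simp
        qed
        then show ?thesis by (simp add: A_def)
      qed
      then have "prob (A n) \<le> exp (- (\<eta> * (sqrt (2 * real n / \<theta>))\<^sup>2 / 2))"
        using tail[OF True] by simp
      also have "\<dots> = exp (- (\<rho> * real n))" using \<theta> by (simp add: \<rho>_def)
      also have "\<dots> \<le> D * exp (- (\<rho> * real n))" using D by simp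
      finally show ?thesis .
    next
      case False
      have "0 \<le> sqrt (2 * real n / \<theta>)" using \<theta> by simp
      with False have "(sqrt (2 * real n / \<theta>))\<^sup>2 \<le> x0\<^sup>2" by (intro power_mono) auto
      then have "2 * real n / \<theta> \<le> x0\<^sup>2" using \<theta> by simp
      then have "real n \<le> \<theta> * x0\<^sup>2 / 2" using \<theta> by (simp add: field_simps)
      then have "0 \<le> \<rho> * (\<theta> * x0\<^sup>2 / 2) + - (\<rho> * real n)" using \<rho> by (simp add: mult_left_mono)
      then have "1 \<le> D * exp (- (\<rho> * real n))" unfolding D_def mult_exp_exp by simp
      then show ?thesis using prob_le_1[of "A n"] by linarith
    qed
    have "(\<integral>\<^sup>+\<omega>. ennreal (exp (Z \<omega>)) \<partial>M)
        \<le> (\<integral>\<^sup>+\<omega>. 1 + (\<Sum>n. ennreal (exp (real n + 1)) * indicator (A n) \<omega>) \<partial>M)"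
    proof (rule nn_integral_mono)
      fix \<omega> assume \<omega>: "\<omega> \<in> space M"
      show "ennreal (exp (Z \<omega>)) \<le> 1 + (\<Sum>n. ennreal (exp (real n + 1)) * indicator (A n) \<omega>)"
      proof (cases "Z \<omega> \<le> 0")
        case True
        then have "ennreal (exp (Z \<omega>)) \<le> 1" using ennreal_leI[of "exp (Z \<omega>)" 1] by simp
        then show ?thesis by (meson order_trans le_iff_add)
      next
        case False
        \<comment> \<open>The ceiling minus one, not the floor: \<open>A n\<close> asks for
          \<open>Z \<omega>\<close> strictly above \<open>n\<close>, also when
          \<open>Z \<omega>\<close> is an integer.\<close>
        define n where "n = nat (\<lceil>Z \<omega>\<rceil> - 1)"
        have "real n < Z \<omega>" "Z \<omega> \<le> real n + 1"
          using False unfolding n_def by linarith+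
        then have "ennreal (exp (Z \<omega>)) \<le> ennreal (exp (real n + 1)) * indicator (A n) \<omega>"
          using \<omega> by (simp add: A_def ennreal_leI)
        also have "\<dots> \<le> (\<Sum>n. ennreal (exp (real n + 1)) * indicator (A n) \<omega>)"
          using sum_le_suminf[of f "{n}" for f :: "nat \<Rightarrow> ennreal"] by simp
        also have "\<dots> \<le> 1 + \<dots>" by simp
        finally show ?thesis .
      qed
    qed
    also have "\<dots> = 1 + (\<Sum>n. ennreal (exp (real n + 1)) * emeasure M (A n))"
      by (subst nn_integral_add) (simp_all add: nn_integral_suminf nn_integral_cmult_indicator emeasure_space_1)
    also have "\<dots> \<le> 1 + (\<Sum>n. ennreal (g n))"
    proof (intro add_left_mono suminf_le)
      show "ennreal (exp (real n + 1)) * emeasure M (A n) \<le> ennreal (g n)" for n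
        unfolding g_def emeasure_eq_measure using prob_A[of n]
        by (simp add: ennreal_mult[symmetric] ennreal_leI)
    qed auto
    also have "\<dots> = ennreal C"
      using suminf_ennreal2[OF g0 summable] suminf_nonneg[OF summable g0]
      by (simp add: C_def ennreal_plus)
    finally show "(\<integral>\<^sup>+\<omega>. ennreal (exp (\<theta> * (X \<omega>)\<^sup>2 / 2)) \<partial>M) \<le> ennreal C"
      by (simp add: Z_def)
  qed
qed

lemma (in prob_space) indep_var_nn_integral:
  fixes F G :: "'a \<Rightarrow> ennreal"
  assumes "indep_var borel F borel G"
  shows "(\<integral>\<^sup>+\<omega>. F \<omega> * G \<omega> \<partial>M) = (\<integral>\<^sup>+\<omega>. F \<omega> \<partial>M) * (\<integral>\<^sup>+\<omega>. G \<omega> \<partial>M)"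
proof -
  have "case_bool borel borel = (\<lambda>_. borel :: ennreal measure)" by (auto split: bool.split)
  then have "indep_vars (\<lambda>_. borel) (case_bool F G) UNIV"
    using assms by (metis indep_var_def)
  from indep_vars_nn_integral[OF _ this] show ?thesis by (simp add: UNIV_bool mult.commute)
qed

text \<open>An exponential Markov inequality. The exponential of the sum is a product of
  \<open>2 * card J\<close> independent factors, each of expectation at most \<open>C\<close>;
  independence is used within \<open>a\<close>, within \<open>b\<close>, and between the two
  sequences.\<close>

lemma (in prob_space) window_sum_tail:
  fixes a b :: "nat \<Rightarrow> 'a \<Rightarrow> real"
  assumes indep_a: "indep_vars (\<lambda>_. borel) a I"
    and indep_b: "indep_vars (\<lambda>_. borel) b I"
    and indep_ab: "indep_var (\<Pi>\<^sub>M i\<in>I. borel) (\<lambda>\<omega>. \<lambda>i\<in>I. a i \<omega>) (\<Pi>\<^sub>M i\<in>I. borel) (\<lambda>\<omega>. \<lambda>i\<in>I. b i \<omega>)"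
    and J: "finite J" "J \<subseteq> I" and C: "C \<ge> 1"
    and a: "\<And>i. i \<in> J \<Longrightarrow> (\<integral>\<^sup>+\<omega>. ennreal (exp (\<theta> * (a i \<omega>)\<^sup>2 / 2)) \<partial>M) \<le> ennreal C"
    and b: "\<And>i. i \<in> J \<Longrightarrow> (\<integral>\<^sup>+\<omega>. ennreal (exp (\<theta> * (sqrt 2 * b i \<omega>)\<^sup>2 / 2)) \<partial>M) \<le> ennreal C"
    and \<theta>: "\<theta> > 0"
  shows "prob {\<omega> \<in> space M. (\<Sum>i\<in>J. (a i \<omega>)\<^sup>2 + 2 * (b i \<omega>)\<^sup>2) \<ge> S} \<le> C ^ (2 * card J) * exp (- (\<theta> * S / 2))"
proof -
  have [measurable]: "a i \<in> borel_measurable M" "b i \<in> borel_measurable M" if "i \<in> J" for i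
    using that J indep_a indep_b by (auto simp: indep_vars_def)
  have pow: "(\<integral>\<^sup>+\<omega>. (\<Prod>i\<in>J. ennreal (exp (\<theta> * (X i \<omega>)\<^sup>2 / 2))) \<partial>M) \<le> ennreal C ^ card J"
    if "indep_vars (\<lambda>_. borel) X I"
      and "\<And>i. i \<in> J \<Longrightarrow> (\<integral>\<^sup>+\<omega>. ennreal (exp (\<theta> * (X i \<omega>)\<^sup>2 / 2)) \<partial>M) \<le> ennreal C"
    for X :: "nat \<Rightarrow> 'a \<Rightarrow> real"
  proof -
    have "indep_vars (\<lambda>_. borel) (\<lambda>i \<omega>. ennreal (exp (\<theta> * (X i \<omega>)\<^sup>2 / 2))) J"
      by (rule indep_vars_compose2[OF indep_vars_subset[OF that(1) J(2)]]) measurable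
    from indep_vars_nn_integral[OF J(1) this]
    have "(\<integral>\<^sup>+\<omega>. (\<Prod>i\<in>J. ennreal (exp (\<theta> * (X i \<omega>)\<^sup>2 / 2))) \<partial>M)
        = (\<Prod>i\<in>J. \<integral>\<^sup>+\<omega>. ennreal (exp (\<theta> * (X i \<omega>)\<^sup>2 / 2)) \<partial>M)" by simp
    also have "\<dots> \<le> (\<Prod>i\<in>J. ennreal C)" by (intro prod_mono_ennreal that(2))
    finally show ?thesis by simp
  qed
  define A where "A \<omega> = (\<Prod>i\<in>J. ennreal (exp (\<theta> * (a i \<omega>)\<^sup>2 / 2)))" for \<omega>
  define B where "B \<omega> = (\<Prod>i\<in>J. ennreal (exp (\<theta> * (sqrt 2 * b i \<omega>)\<^sup>2 / 2)))" for \<omega>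
  have [measurable]: "A \<in> borel_measurable M" "B \<in> borel_measurable M"
    unfolding A_def B_def by measurable
  have [measurable]: "(\<lambda>f. f i) \<in> borel_measurable (\<Pi>\<^sub>M i\<in>I. borel :: real measure)" if "i \<in> J" for i
    using that J(2) by (intro measurable_component_singleton) auto
  \<comment> \<open>\<open>A\<close> and \<open>B\<close> are measurable functions of the two whole
    sequences, so they inherit the independence of these.\<close>
  have "indep_var borel ((\<lambda>f. \<Prod>i\<in>J. ennreal (exp (\<theta> * (f i)\<^sup>2 / 2))) \<circ> (\<lambda>\<omega>. \<lambda>i\<in>I. a i \<omega>))
      borel ((\<lambda>f. \<Prod>i\<in>J. ennreal (exp (\<theta> * (sqrt 2 * f i)\<^sup>2 / 2))) \<circ> (\<lambda>\<omega>. \<lambda>i\<in>I. b i \<omega>))"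
    by (intro indep_var_compose[OF indep_ab]) measurable
  also have "(\<lambda>f. \<Prod>i\<in>J. ennreal (exp (\<theta> * (f i)\<^sup>2 / 2))) \<circ> (\<lambda>\<omega>. \<lambda>i\<in>I. a i \<omega>) = A"
    using J(2) by (auto simp: A_def fun_eq_iff intro!: prod.cong)
  also have "(\<lambda>f. \<Prod>i\<in>J. ennreal (exp (\<theta> * (sqrt 2 * f i)\<^sup>2 / 2))) \<circ> (\<lambda>\<omega>. \<lambda>i\<in>I. b i \<omega>) = B"
    using J(2) by (auto simp: B_def fun_eq_iff intro!: prod.cong)
  finally have AB: "indep_var borel A borel B" .
  have indep_b': "indep_vars (\<lambda>_. borel) (\<lambda>i \<omega>. sqrt 2 * b i \<omega>) I"
    by (rule indep_vars_compose2[OF indep_b]) measurable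
  have bound: "(\<integral>\<^sup>+\<omega>. A \<omega> * B \<omega> \<partial>M) \<le> ennreal (C ^ (2 * card J))"
  proof -
    have "(\<integral>\<^sup>+\<omega>. A \<omega> * B \<omega> \<partial>M) \<le> ennreal C ^ card J * ennreal C ^ card J"
      unfolding indep_var_nn_integral[OF AB] unfolding A_def B_def
      by (intro mult_mono pow indep_a indep_b' a b) auto
    then show ?thesis using C by (simp add: ennreal_power mult_2 power_add flip: ennreal_mult)
  qed
  have AB_eq: "A \<omega> * B \<omega> = ennreal (exp (\<theta> * (\<Sum>i\<in>J. (a i \<omega>)\<^sup>2 + 2 * (b i \<omega>)\<^sup>2) / 2))" for \<omega>
    unfolding A_def B_def using J(1)
    by (simp add: prod_ennreal power_mult_distrib sum.distrib distrib_left add_divide_distrib exp_add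
        sum_distrib_left sum_divide_distrib flip: ennreal_mult exp_sum)
  define c where "c = exp (- (\<theta> * S / 2))"
  have "{\<omega> \<in> space M. (\<Sum>i\<in>J. (a i \<omega>)\<^sup>2 + 2 * (b i \<omega>)\<^sup>2) \<ge> S}
      = {\<omega> \<in> space M. 1 \<le> ennreal c * (A \<omega> * B \<omega>)}"
  proof (intro Collect_cong conj_cong refl)
    fix \<omega>
    have "ennreal c * (A \<omega> * B \<omega>) = ennreal (exp (\<theta> * (\<Sum>i\<in>J. (a i \<omega>)\<^sup>2 + 2 * (b i \<omega>)\<^sup>2) / 2 - \<theta> * S / 2))"
      unfolding AB_eq c_def by (simp add: mult_exp_exp flip: ennreal_mult)
    also have "1 \<le> \<dots> \<longleftrightarrow> \<theta> * S \<le> \<theta> * (\<Sum>i\<in>J. (a i \<omega>)\<^sup>2 + 2 * (b i \<omega>)\<^sup>2)" by simp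
    also have "\<dots> \<longleftrightarrow> S \<le> (\<Sum>i\<in>J. (a i \<omega>)\<^sup>2 + 2 * (b i \<omega>)\<^sup>2)"
      using \<theta> by (rule mult_le_cancel_left_pos)
    finally show "S \<le> (\<Sum>i\<in>J. (a i \<omega>)\<^sup>2 + 2 * (b i \<omega>)\<^sup>2) \<longleftrightarrow> 1 \<le> ennreal c * (A \<omega> * B \<omega>)" ..
  qed
  then have "emeasure M {\<omega> \<in> space M. (\<Sum>i\<in>J. (a i \<omega>)\<^sup>2 + 2 * (b i \<omega>)\<^sup>2) \<ge> S}
      \<le> ennreal c * (\<integral>\<^sup>+\<omega>. A \<omega> * B \<omega> * indicator (space M) \<omega> \<partial>M)"
    using nn_integral_Markov_inequality[of "\<lambda>\<omega>. A \<omega> * B \<omega>" "space M" M "ennreal c"] by simp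
  also have "\<dots> = ennreal c * (\<integral>\<^sup>+\<omega>. A \<omega> * B \<omega> \<partial>M)"
    by (simp cong: nn_integral_cong)
  also have "\<dots> \<le> ennreal c * ennreal (C ^ (2 * card J))" by (intro mult_left_mono bound) simp
  also have "\<dots> = ennreal (C ^ (2 * card J) * c)" using C by (simp add: c_def mult.commute flip: ennreal_mult)
  finally show ?thesis using C by (simp add: emeasure_eq_measure c_def)
qed

text \<open>Independence gives a product of factors at most \<open>1 - p\<close>, and
  \<open>1 - p \<le> exp (- p)\<close>.\<close>

lemma (in prob_space) prob_all_le:
  fixes a :: "nat \<Rightarrow> 'a \<Rightarrow> real"
  assumes indep_a: "indep_vars (\<lambda>_. borel) a I"
    and J: "finite J" "J \<noteq> {}" "J \<subseteq> I"
    and p: "\<And>i. i \<in> J \<Longrightarrow> p \<le> prob {\<omega> \<in> space M. a i \<omega> > t}"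
  shows "prob {\<omega> \<in> space M. \<forall>i\<in>J. a i \<omega> \<le> t} \<le> exp (- (real (card J) * p))"
proof -
  have [measurable]: "a i \<in> borel_measurable M" if "i \<in> J" for i
    using that J indep_a by (auto simp: indep_vars_def)
  have "{\<omega> \<in> space M. \<forall>i\<in>J. a i \<omega> \<le> t} = (\<Inter>i\<in>J. a i -` {..t} \<inter> space M)"
    using J(2) by auto
  then have "prob {\<omega> \<in> space M. \<forall>i\<in>J. a i \<omega> \<le> t} = (\<Prod>i\<in>J. prob (a i -` {..t} \<inter> space M))"
    using indep_varsD[OF indep_a J(2,1,3), of "\<lambda>_. {..t}"] by simp
  also have "\<dots> \<le> (\<Prod>i\<in>J. exp (- p))"
  proof (rule prod_mono, rule conjI)
    fix i assume i: "i \<in> J"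
    have "a i -` {..t} \<inter> space M = space M - {\<omega> \<in> space M. a i \<omega> > t}" by auto
    then have "prob (a i -` {..t} \<inter> space M) = 1 - prob {\<omega> \<in> space M. a i \<omega> > t}"
      using i by (simp add: prob_compl)
    also have "\<dots> \<le> 1 - p" using p[OF i] by simp
    also have "\<dots> \<le> exp (- p)" using exp_ge_add_one_self[of "- p"] by simp
    finally show "prob (a i -` {..t} \<inter> space M) \<le> exp (- p)" .
  qed simp
  also have "\<dots> = exp (- (real (card J) * p))"
    by (simp flip: exp_of_nat_mult)
  finally show ?thesis .
qed

section \<open>Large deviations with rate function \<open>I2\<close>\<close>

lemma elog_divide_le_iff:
  assumes "L > 0"
  shows "elog p / ereal L \<le> ereal c \<longleftrightarrow> p \<le> exp (c * L)"
  using assms by (subst ereal_divide_le_pos) (auto simp: elog_le_ereal_iff mult.commute)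

lemma le_elog_divide_iff:
  assumes "L > 0"
  shows "ereal c \<le> elog p / ereal L \<longleftrightarrow> exp (c * L) \<le> p"
  using assms by (subst ereal_le_divide_pos) (auto simp: ereal_le_elog_iff mult.commute)

lemma closed_I2_sublevel: "closed {x. I2 x \<le> c}"
proof (cases c)
  case (real r)
  have "{x. I2 x \<le> c} = {1..} \<inter> {x. x\<^sup>2 - 1 \<le> r}"
    using real by (auto simp: I2_def)
  also have "closed \<dots>" by (intro closed_Int closed_Collect_le continuous_intros)
  finally show ?thesis .
next
  case PInf
  then show ?thesis by simp
next
  case MInf
  then show ?thesis by (simp add: I2_def)
qed

lemma I2_nonneg: "0 \<le> I2 x"
  by (simp add: I2_def)

lemma eventually_le_mult_ln:
  assumes "t > 0"
  shows "\<forall>\<^sub>F N in sequentially. c \<le> t * ln (real N)"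
proof -
  have "filterlim (\<lambda>N. t * ln (real N)) at_top sequentially" using assms by real_asymp
  then show ?thesis by (simp add: filterlim_at_top)
qed

lemma eventually_ln_pos: "\<forall>\<^sub>F N in sequentially. 0 < ln (real N)"
  using eventually_gt_at_top[of 1] by eventually_elim simp

text \<open>A short interval inside \<open>U\<close>, just to the right of \<open>x\<close>, has
  probability at least \<open>P (Y > y) - P (Y \<ge> y + t)\<close>. The second term decays with a
  strictly larger power of \<open>N\<close>, hence is eventually at most half of the first. Starting
  at \<open>y > x\<close> also covers \<open>x = 1\<close>, where no tail estimate is
  assumed.\<close>

lemma LDP_I2_lower_bound:
  assumes prob: "\<And>N. prob_space (M N)" and Y: "\<And>N. Y N \<in> borel_measurable (M N)"
    and upper: "\<And>x \<epsilon>. x > 1 \<Longrightarrow> \<epsilon> > 0 \<Longrightarrow> \<forall>\<^sub>F N in sequentially.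
      measure (M N) {\<omega> \<in> space (M N). x \<le> Y N \<omega>} \<le> exp ((1 - x\<^sup>2 + \<epsilon>) * ln (real N))"
    and lower: "\<And>x \<epsilon>. x > 1 \<Longrightarrow> \<epsilon> > 0 \<Longrightarrow> \<forall>\<^sub>F N in sequentially.
      exp ((1 - x\<^sup>2 - \<epsilon>) * ln (real N)) \<le> measure (M N) {\<omega> \<in> space (M N). x < Y N \<omega>}"
    and U: "open U" and x: "x \<in> U" "x \<ge> 1"
  shows "ereal (1 - x\<^sup>2) \<le> liminf (\<lambda>N. elog (measure (M N) {\<omega> \<in> space (M N). Y N \<omega> \<in> U}) / ereal (ln (real N)))"
    (is "_ \<le> ?L")
proof (rule ereal_le_epsilon2)
    fix e' :: real assume "0 < e'"
    \<comment> \<open>Three losses of size at most \<open>e\<close> in the exponent: replacing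
      \<open>x\<close> by \<open>y\<close>, the error \<open>\<delta>\<close> of the tail bound, and
      the factor 1/2.\<close>
    define e where "e = e' / 3"
    have e: "e > 0" using \<open>0 < e'\<close> by (simp add: e_def)
    obtain d where d: "d > 0" "ball x d \<subseteq> U" using U x(1) by (meson openE)
    \<comment> \<open>\<open>d / 3\<close> keeps \<open>y + t = x + 2 * t\<close> inside the ball;
      the other two bounds give \<open>y\<^sup>2 \<le> x\<^sup>2 + e\<close>.\<close>
    define t where "t = min (d / 3) (min 1 (e / (2 * x + 1)))"
    have "t > 0" using d e x by (simp add: t_def)
    moreover have "t \<le> d / 3" "t \<le> 1" "t \<le> e / (2 * x + 1)"
      unfolding t_def by linarith+
    ultimately have t: "t > 0" "t \<le> d / 3" "t \<le> 1" "t \<le> e / (2 * x + 1)" .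
    define y where "y = x + t"
    have y: "y > 1" using t x by (simp add: y_def)
    have "t * (2 * x + 1) \<le> e" using t(4) x by (simp add: pos_le_divide_eq)
    moreover have "t * t \<le> t" using t by (simp add: mult_left_le)
    ultimately have y2: "y\<^sup>2 \<le> x\<^sup>2 + e" by (simp add: y_def power2_eq_square algebra_simps)
    have yt: "(y + t)\<^sup>2 \<ge> y\<^sup>2 + 2 * t"
    proof -
      have "t \<le> y * t" "0 \<le> t * t" using y t by simp_all
      moreover have "(y + t)\<^sup>2 = y\<^sup>2 + 2 * (y * t) + t * t" by (simp add: power2_eq_square algebra_simps)
      ultimately show ?thesis by linarith
    qed
    \<comment> \<open>The exponents at \<open>y\<close> and \<open>y + t\<close> differ by at least
      \<open>2 * t - 2 * \<delta> \<ge> t\<close>, and \<open>t * L\<close> eventually exceeds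
      \<open>ln 2\<close>.\<close>
    define \<delta> where "\<delta> = min e (t / 2)"
    have \<delta>: "\<delta> > 0" "\<delta> \<le> e" "\<delta> \<le> t / 2" using e t by (auto simp: \<delta>_def)
    have yt1: "y + t > 1" using y t by simp
    have "\<forall>\<^sub>F N in sequentially. ereal (1 - x\<^sup>2 - e') \<le>
        elog (measure (M N) {\<omega> \<in> space (M N). Y N \<omega> \<in> U}) / ereal (ln (real N))"
      using lower[OF y \<delta>(1)] upper[OF yt1 \<delta>(1)]
        eventually_ln_pos eventually_le_mult_ln[OF t(1), of "ln 2"] eventually_le_mult_ln[OF e, of "ln 2"]
    proof eventually_elim
      case (elim N)
      interpret prob_space "M N" by (rule prob)
      have [measurable]: "U \<in> sets borel" using U by simp
      note [measurable] = Y[of N]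
      define L where "L = ln (real N)"
      define E where "E = exp ((1 - y\<^sup>2 - \<delta>) * L)"
      note elim = elim[folded L_def]
      have "exp ((1 - (y + t)\<^sup>2 + \<delta>) * L) \<le> exp ((1 - y\<^sup>2 - \<delta>) * L - ln 2)"
      proof -
        have "(1 - (y + t)\<^sup>2 + \<delta>) * L \<le> (1 - y\<^sup>2 - \<delta> - t) * L"
          using yt \<delta> elim(3) by (intro mult_right_mono) auto
        also have "\<dots> \<le> (1 - y\<^sup>2 - \<delta>) * L - ln 2" using elim(4) by (simp add: algebra_simps)
        finally show ?thesis by simp
      qed
      then have half: "exp ((1 - (y + t)\<^sup>2 + \<delta>) * L) \<le> E / 2" by (simp add: E_def exp_diff)
      have "prob {\<omega> \<in> space (M N). y < Y N \<omega>}
          \<le> prob ({\<omega> \<in> space (M N). Y N \<omega> \<in> U} \<union> {\<omega> \<in> space (M N). y + t \<le> Y N \<omega>})"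
      proof (rule finite_measure_mono)
        show "{\<omega> \<in> space (M N). y < Y N \<omega>}
            \<subseteq> {\<omega> \<in> space (M N). Y N \<omega> \<in> U} \<union> {\<omega> \<in> space (M N). y + t \<le> Y N \<omega>}"
        proof (intro subsetI)
          fix \<omega> assume "\<omega> \<in> {\<omega> \<in> space (M N). y < Y N \<omega>}"
          moreover have "z \<in> U" if "y < z" "z < y + t" for z
            using that t d x by (intro subsetD[OF d(2)]) (auto simp: y_def dist_real_def)
          ultimately show "\<omega> \<in> {\<omega> \<in> space (M N). Y N \<omega> \<in> U} \<union> {\<omega> \<in> space (M N). y + t \<le> Y N \<omega>}"
            by force
        qed
      qed measurable
      also have "\<dots> \<le> prob {\<omega> \<in> space (M N). Y N \<omega> \<in> U} + prob {\<omega> \<in> space (M N). y + t \<le> Y N \<omega>}"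
        by (intro measure_Un_le) measurable
      finally have "E / 2 \<le> prob {\<omega> \<in> space (M N). Y N \<omega> \<in> U}"
        using elim(1,2) half by (simp add: E_def)
      moreover have "exp ((1 - x\<^sup>2 - e') * L) \<le> E / 2"
      proof -
        have "(1 - x\<^sup>2 - e') * L \<le> (1 - y\<^sup>2 - \<delta> - e) * L"
          using y2 \<delta> elim(3) by (intro mult_right_mono) (auto simp: e_def)
        also have "\<dots> \<le> (1 - y\<^sup>2 - \<delta>) * L - ln 2" using elim(5) by (simp add: algebra_simps)
        finally have "exp ((1 - x\<^sup>2 - e') * L) \<le> exp ((1 - y\<^sup>2 - \<delta>) * L - ln 2)" by simp
        then show ?thesis by (simp add: E_def exp_diff)
      qed
      ultimately show ?case using elim(3) by (subst L_def[symmetric], subst le_elog_divide_iff) auto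
    qed
    then have "ereal (1 - x\<^sup>2 - e') \<le> ?L" by (rule Liminf_bounded)
    then have "ereal (1 - x\<^sup>2 - e') + ereal e' \<le> ?L + ereal e'" by (rule add_right_mono)
    then show "ereal (1 - x\<^sup>2) \<le> ?L + ereal e'" by simp
qed

text \<open>If \<open>1 \<in> F\<close>, the infimum is 0 and the trivial bound is enough. Otherwise
  \<open>F\<close> keeps a distance from 1 and splits into a part below some \<open>c < 1\<close>,
  negligible at this speed, and a part above its least point \<open>x > 1\<close>, where
  \<open>I2\<close> attains the infimum.\<close>

lemma LDP_I2_upper_bound:
  assumes prob: "\<And>N. prob_space (M N)" and Y: "\<And>N. Y N \<in> borel_measurable (M N)"
    and upper: "\<And>x \<epsilon>. x > 1 \<Longrightarrow> \<epsilon> > 0 \<Longrightarrow> \<forall>\<^sub>F N in sequentially.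
      measure (M N) {\<omega> \<in> space (M N). x \<le> Y N \<omega>} \<le> exp ((1 - x\<^sup>2 + \<epsilon>) * ln (real N))"
    and left: "\<And>c K. c < 1 \<Longrightarrow> \<forall>\<^sub>F N in sequentially.
      measure (M N) {\<omega> \<in> space (M N). Y N \<omega> \<le> c} \<le> exp (- K * ln (real N))"
    and F: "closed F"
  shows "limsup (\<lambda>N. elog (measure (M N) {\<omega> \<in> space (M N). Y N \<omega> \<in> F}) / ereal (ln (real N)))
    \<le> - (INF x\<in>F. I2 x)" (is "limsup ?f \<le> _")
proof -
  have bound: "limsup ?f \<le> ereal c"
    if "\<forall>\<^sub>F N in sequentially. measure (M N) {\<omega> \<in> space (M N). Y N \<omega> \<in> F} \<le> exp (c * ln (real N))" for c
  proof (rule Limsup_bounded)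
    show "\<forall>\<^sub>F N in sequentially. ?f N \<le> ereal c"
      using that eventually_ln_pos by eventually_elim (simp add: elog_divide_le_iff)
  qed
  show ?thesis
  proof (cases "1 \<in> F")
    case True
    have "measure (M N) {\<omega> \<in> space (M N). Y N \<omega> \<in> F} \<le> exp (0 * ln (real N))" for N
      using prob_space.prob_le_1[OF prob[of N]] by simp
    then have "\<forall>\<^sub>F N in sequentially. measure (M N) {\<omega> \<in> space (M N). Y N \<omega> \<in> F} \<le> exp (0 * ln (real N))"
      by (rule always_eventually[OF allI])
    then have "limsup ?f \<le> ereal 0" by (rule bound)
    have "(INF x\<in>F. I2 x) \<le> I2 1" by (rule INF_lower[OF True])
    also have "I2 1 = 0" by (simp add: I2_def)
    finally have "0 \<le> - (INF x\<in>F. I2 x)" by (simp only: ereal_0_le_uminus_iff)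
    with \<open>limsup ?f \<le> ereal 0\<close> show ?thesis unfolding zero_ereal_def by (rule order_trans)
  next
    case False
    then have "open (- F)" "1 \<in> - F" using F by auto
    then obtain d where d: "d > 0" "ball 1 d \<subseteq> - F" by (meson openE)
    define c where "c = 1 - d"
    have c: "c < 1" using d by (simp add: c_def)
    have gap: "z \<le> c \<or> 1 + d \<le> z" if "z \<in> F" for z
    proof (rule ccontr)
      assume "\<not> ?thesis"
      then have "z \<in> ball 1 d" by (auto simp: c_def dist_real_def)
      with d that show False by blast
    qed
    show ?thesis
    proof (cases "F \<inter> {1..} = {}")
      case True
      \<comment> \<open>Only the left part remains and the infimum is infinite, so every power of
        \<open>N\<close> has to be beaten; \<open>K\<close> in \<open>left\<close> is
        arbitrary.\<close>
      have "limsup ?f \<le> ereal B" for B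
      proof (rule bound)
        show "\<forall>\<^sub>F N in sequentially. measure (M N) {\<omega> \<in> space (M N). Y N \<omega> \<in> F} \<le> exp (B * ln (real N))"
          using left[OF c, of "- B"]
        proof eventually_elim
          case (elim N)
          interpret prob_space "M N" by (rule prob)
          note [measurable] = Y[of N]
          have "z \<le> c" if "z \<in> F" for z using gap[OF that] that True d by auto
          then have "prob {\<omega> \<in> space (M N). Y N \<omega> \<in> F} \<le> prob {\<omega> \<in> space (M N). Y N \<omega> \<le> c}"
            by (intro finite_measure_mono) auto
          with elim show ?case by simp
        qed
      qed
      then have "limsup ?f = - \<infinity>" by (rule ereal_bot)
      then show ?thesis by simp
    next
      case ne: False
      define x where "x = Inf (F \<inter> {1..})"
      have bdd: "bdd_below (F \<inter> {1..})" by (auto intro: bdd_belowI[of _ 1])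
      have "x \<in> F \<inter> {1..}"
        unfolding x_def by (rule closed_contains_Inf[OF ne bdd]) (use F in auto)
      then have "x \<in> F" "x \<ge> 1" "x \<noteq> 1" using False by auto
      then have x: "x \<in> F" "x > 1" by simp_all
      have x_le: "x \<le> z" if "z \<in> F" "z \<ge> 1" for z
        unfolding x_def using that bdd by (intro cInf_lower) auto
      have "limsup ?f \<le> ereal (1 - x\<^sup>2)"
      proof (rule ereal_le_epsilon2)
        fix e :: real assume e: "0 < e"
        then have e2: "0 < e / 2" by simp
        have "limsup ?f \<le> ereal (1 - x\<^sup>2 + e)"
        proof (rule bound)
          show "\<forall>\<^sub>F N in sequentially.
              measure (M N) {\<omega> \<in> space (M N). Y N \<omega> \<in> F} \<le> exp ((1 - x\<^sup>2 + e) * ln (real N))"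
            \<comment> \<open>\<open>K = x\<^sup>2\<close> makes the left part no larger than the
              bound for the right part; the resulting factor 2 is absorbed by the other half of
              \<open>e\<close>.\<close>
            using left[OF c, of "x\<^sup>2"] upper[OF x(2) e2] eventually_ln_pos eventually_le_mult_ln[OF e2, of "ln 2"]
          proof eventually_elim
            case (elim N)
            interpret prob_space "M N" by (rule prob)
            note [measurable] = Y[of N]
            define L where "L = ln (real N)"
            note elim = elim[folded L_def]
            have "prob {\<omega> \<in> space (M N). Y N \<omega> \<in> F}
                \<le> prob ({\<omega> \<in> space (M N). Y N \<omega> \<le> c} \<union> {\<omega> \<in> space (M N). x \<le> Y N \<omega>})"
            proof (rule finite_measure_mono)
              have "z \<le> c \<or> x \<le> z" if "z \<in> F" for z using gap[OF that] x_le[OF that] d by auto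
              then show "{\<omega> \<in> space (M N). Y N \<omega> \<in> F}
                  \<subseteq> {\<omega> \<in> space (M N). Y N \<omega> \<le> c} \<union> {\<omega> \<in> space (M N). x \<le> Y N \<omega>}" by blast
            qed measurable
            also have "\<dots> \<le> prob {\<omega> \<in> space (M N). Y N \<omega> \<le> c} + prob {\<omega> \<in> space (M N). x \<le> Y N \<omega>}"
              by (intro measure_Un_le) measurable
            also have "\<dots> \<le> exp ((1 - x\<^sup>2 + e / 2) * L) + exp ((1 - x\<^sup>2 + e / 2) * L)"
            proof (rule add_mono[OF order_trans[OF elim(1)] elim(2)])
              show "exp (- x\<^sup>2 * L) \<le> exp ((1 - x\<^sup>2 + e / 2) * L)"
                unfolding exp_le_cancel_iff using elim(3) e by (intro mult_right_mono) auto
            qed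
            also have "\<dots> = exp (ln 2 + (1 - x\<^sup>2 + e / 2) * L)" by (simp add: exp_add)
            also have "\<dots> \<le> exp ((1 - x\<^sup>2 + e) * L)"
              unfolding exp_le_cancel_iff using elim(4) by (simp add: algebra_simps)
            finally show ?case by (simp add: L_def)
          qed
        qed
        then show "limsup ?f \<le> ereal (1 - x\<^sup>2) + ereal e" by simp
      qed
      also have "\<dots> = - I2 x" using x by (simp add: I2_def)
      also have "\<dots> \<le> - (INF x\<in>F. I2 x)" using x by (auto intro: INF_lower)
      finally show ?thesis .
    qed
  qed
qed

text \<open>Three tail estimates determine the whole principle because \<open>I2\<close> is
  increasing on the half-line from 1 and infinite to the left of it.\<close>

lemma satisfies_LDP_I2I:
  assumes "\<And>N. prob_space (M N)" and "\<And>N. Y N \<in> borel_measurable (M N)"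
    and "\<And>x \<epsilon>. x > 1 \<Longrightarrow> \<epsilon> > 0 \<Longrightarrow> \<forall>\<^sub>F N in sequentially.
      measure (M N) {\<omega> \<in> space (M N). x \<le> Y N \<omega>} \<le> exp ((1 - x\<^sup>2 + \<epsilon>) * ln (real N))"
    and "\<And>x \<epsilon>. x > 1 \<Longrightarrow> \<epsilon> > 0 \<Longrightarrow> \<forall>\<^sub>F N in sequentially.
      exp ((1 - x\<^sup>2 - \<epsilon>) * ln (real N)) \<le> measure (M N) {\<omega> \<in> space (M N). x < Y N \<omega>}"
    and "\<And>c K. c < 1 \<Longrightarrow> \<forall>\<^sub>F N in sequentially.
      measure (M N) {\<omega> \<in> space (M N). Y N \<omega> \<le> c} \<le> exp (- K * ln (real N))"
  shows "satisfies_LDP M Y (\<lambda>N. ln (real N)) I2"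
  unfolding satisfies_LDP_def
proof (intro conjI allI impI)
  show "filterlim (\<lambda>N. ln (real N)) at_top sequentially" by real_asymp
  fix U :: "real set" assume U: "open U"
  let ?L = "liminf (\<lambda>N. elog (measure (M N) {\<omega> \<in> space (M N). Y N \<omega> \<in> U}) / ereal (ln (real N)))"
  have "- ?L \<le> I2 x" if "x \<in> U" for x
  proof (cases "x \<ge> 1")
    case True
    have "ereal (1 - x\<^sup>2) \<le> ?L" by (rule LDP_I2_lower_bound[OF assms(1-4) U that True])
    moreover have "- I2 x = ereal (1 - x\<^sup>2)" using True by (simp add: I2_def)
    ultimately show ?thesis by (subst ereal_uminus_le_reorder) simp
  next
    case False
    then show ?thesis by (simp add: I2_def)
  qed
  then have "- ?L \<le> (INF x\<in>U. I2 x)" by (rule INF_greatest)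
  then show "- (INF x\<in>U. I2 x) \<le> ?L" by (subst ereal_uminus_le_reorder)
next
  fix F :: "real set" assume "closed F"
  then show "limsup (\<lambda>N. elog (measure (M N) {\<omega> \<in> space (M N). Y N \<omega> \<in> F}) / ereal (ln (real N)))
    \<le> - (INF x\<in>F. I2 x)"
    by (intro LDP_I2_upper_bound assms)
qed (auto simp: I2_nonneg closed_I2_sublevel assms(2))

section \<open>Entries with Gaussian tails\<close>

lemma
  assumes ugt: "uniform_gaussian_tail ({N0..} \<times> {1..}) (\<lambda>(N, i). M N) (\<lambda>(N, i). X N i)" and e: "\<epsilon> > 0"
  shows uniform_gaussian_tail_array_upper: "\<exists>x0. \<forall>x\<ge>x0. \<forall>N\<ge>N0. \<forall>i\<ge>1::nat.
      measure (M N) {\<omega> \<in> space (M N). \<bar>X N i \<omega>\<bar> > x} \<le> exp (- ((1 - \<epsilon>) * x\<^sup>2 / 2))"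
    and uniform_gaussian_tail_array_lower: "\<exists>x0. \<forall>x\<ge>x0. \<forall>N\<ge>N0. \<forall>i\<ge>1::nat.
      exp (- ((1 + \<epsilon>) * x\<^sup>2 / 2)) \<le> measure (M N) {\<omega> \<in> space (M N). X N i \<omega> > x}"
proof -
  have "\<exists>x0. \<forall>x\<ge>x0. \<forall>N\<ge>N0. \<forall>i\<ge>1.
      measure (M N) {\<omega> \<in> space (M N). \<bar>X N i \<omega>\<bar> > x} \<le> exp (- ((1 - \<epsilon>) * x\<^sup>2 / 2)) \<and>
      exp (- ((1 + \<epsilon>) * x\<^sup>2 / 2)) \<le> measure (M N) {\<omega> \<in> space (M N). X N i \<omega> > x}"
  proof (rule uniform_gaussian_tail_bounds[OF ugt e], intro exI allI impI)
    fix x0 x N i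
    assume upper: "\<And>x p. x0 \<le> x \<Longrightarrow> p \<in> {N0..} \<times> {1..} \<Longrightarrow>
        measure (case p of (N, i) \<Rightarrow> M N)
          {\<omega> \<in> space (case p of (N, i) \<Rightarrow> M N). x < \<bar>(case p of (N, i) \<Rightarrow> X N i) \<omega>\<bar>}
        \<le> exp (- ((1 - \<epsilon>) * x\<^sup>2 / 2))"
      and lower: "\<And>x p. x0 \<le> x \<Longrightarrow> p \<in> {N0..} \<times> {1..} \<Longrightarrow>
        exp (- ((1 + \<epsilon>) * x\<^sup>2 / 2)) \<le> measure (case p of (N, i) \<Rightarrow> M N)
          {\<omega> \<in> space (case p of (N, i) \<Rightarrow> M N). x < (case p of (N, i) \<Rightarrow> X N i) \<omega>}"
    assume x: "x0 \<le> x" and "N0 \<le> N" "1 \<le> (i::nat)"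
    then have p: "(N, i) \<in> {N0..} \<times> {1..}" by simp
    show "measure (M N) {\<omega> \<in> space (M N). \<bar>X N i \<omega>\<bar> > x} \<le> exp (- ((1 - \<epsilon>) * x\<^sup>2 / 2)) \<and>
        exp (- ((1 + \<epsilon>) * x\<^sup>2 / 2)) \<le> measure (M N) {\<omega> \<in> space (M N). X N i \<omega> > x}"
      using upper[OF x p] lower[OF x p] by simp
  qed
  then show "\<exists>x0. \<forall>x\<ge>x0. \<forall>N\<ge>N0. \<forall>i\<ge>1.
      measure (M N) {\<omega> \<in> space (M N). \<bar>X N i \<omega>\<bar> > x} \<le> exp (- ((1 - \<epsilon>) * x\<^sup>2 / 2))"
    and "\<exists>x0. \<forall>x\<ge>x0. \<forall>N\<ge>N0. \<forall>i\<ge>1.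
      exp (- ((1 + \<epsilon>) * x\<^sup>2 / 2)) \<le> measure (M N) {\<omega> \<in> space (M N). X N i \<omega> > x}"
    by blast+
qed

locale gaussian_tail_entries =
  fixes M :: "nat \<Rightarrow> 'a measure" and a b :: "nat \<Rightarrow> nat \<Rightarrow> 'a \<Rightarrow> real"
  assumes prob: "\<And>N. prob_space (M N)"
    and indep_a: "\<And>N. prob_space.indep_vars (M N) (\<lambda>_. borel) (a N) {1..}"
    and indep_b: "\<And>N. prob_space.indep_vars (M N) (\<lambda>_. borel) (b N) {1..}"
    and indep_ab: "\<And>N. prob_space.indep_var (M N)
          (\<Pi>\<^sub>M i\<in>{1..}. borel) (\<lambda>\<omega>. \<lambda>i\<in>{1..}. a N i \<omega>)
          (\<Pi>\<^sub>M i\<in>{1..}. borel) (\<lambda>\<omega>. \<lambda>i\<in>{1..}. b N i \<omega>)"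
    and tail: "\<exists>N0.
          uniform_gaussian_tail ({N0..} \<times> {1..}) (\<lambda>(N, i). M N) (\<lambda>(N, i). a N i) \<and>
          uniform_gaussian_tail ({N0..} \<times> {1..}) (\<lambda>(N, i). M N) (\<lambda>(N, i) \<omega>. sqrt 2 * b N i \<omega>)"
begin

lemma measurable_a: "i \<ge> 1 \<Longrightarrow> a N i \<in> borel_measurable (M N)"
  using indep_a[of N] unfolding prob_space.indep_vars_def[OF prob] by simp

lemma measurable_b: "i \<ge> 1 \<Longrightarrow> b N i \<in> borel_measurable (M N)"
  using indep_b[of N] unfolding prob_space.indep_vars_def[OF prob] by simp

section \<open>Maximum of the diagonal and union bound over windows\<close>

text \<open>The inner exponential is a lower bound for the expected number of diagonal entries above
  the level. For \<open>c < 1\<close> and small \<open>\<epsilon>\<close> it is a positive power of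
  \<open>N\<close>, which gives the left tail; for \<open>c > 1\<close> it is a negative power and
  \<open>1 - exp (- u)\<close> is of order \<open>u\<close>, which gives the lower bound on the
  right tail.\<close>

lemma all_le_bound:
  assumes c: "c > 0" and e: "\<epsilon> > 0"
  shows "\<forall>\<^sub>F N in sequentially.
    measure (M N) {\<omega> \<in> space (M N). \<forall>i\<in>{1..N}. a N i \<omega> \<le> c * sqrt (2 * ln (real N))}
      \<le> exp (- exp ((1 - (1 + \<epsilon>) * c\<^sup>2) * ln (real N)))"
proof -
  obtain N0 where "uniform_gaussian_tail ({N0..} \<times> {1..}) (\<lambda>(N, i). M N) (\<lambda>(N, i). a N i)"
    using tail by blast
  from uniform_gaussian_tail_array_lower[OF this e] obtain x0
    where lower: "\<forall>x\<ge>x0. \<forall>N\<ge>N0. \<forall>i\<ge>1.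
      exp (- ((1 + \<epsilon>) * x\<^sup>2 / 2)) \<le> measure (M N) {\<omega> \<in> space (M N). a N i \<omega> > x}" ..
  have "filterlim (\<lambda>N. c * sqrt (2 * ln (real N))) at_top sequentially"
    using c by real_asymp
  then have "\<forall>\<^sub>F N in sequentially. x0 \<le> c * sqrt (2 * ln (real N))"
    by (simp add: filterlim_at_top)
  then show ?thesis
    using eventually_ge_at_top[of N0] eventually_gt_at_top[of 1]
  proof eventually_elim
    case (elim N)
    interpret prob_space "M N" by (rule prob)
    define t where "t = c * sqrt (2 * ln (real N))"
    define L where "L = ln (real N)"
    have L: "L > 0" "real N = exp L" using elim by (auto simp: L_def)
    have "t\<^sup>2 / 2 = c\<^sup>2 * L" using L by (simp add: t_def power_mult_distrib flip: L_def)
    then have t: "(1 + \<epsilon>) * t\<^sup>2 / 2 = (1 + \<epsilon>) * (c\<^sup>2 * L)" by simp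
    have "prob {\<omega> \<in> space (M N). \<forall>i\<in>{1..N}. a N i \<omega> \<le> t}
        \<le> exp (- (real (card {1..N}) * exp (- ((1 + \<epsilon>) * t\<^sup>2 / 2))))"
      using elim by (intro prob_all_le[OF indep_a] lower[rule_format]) (auto simp: t_def)
    also have "real (card {1..N}) * exp (- ((1 + \<epsilon>) * t\<^sup>2 / 2)) = exp ((1 - (1 + \<epsilon>) * c\<^sup>2) * L)"
      unfolding t by (simp add: L(2) mult_exp_exp) (simp add: algebra_simps)
    finally show ?case by (simp add: t_def L_def)
  qed
qed

text \<open>The union over windows costs a factor \<open>N\<close> and the moments a constant
  \<open>C ^ (2 * k)\<close> with \<open>k = Suc m\<close>. The 3, against the 2 of the
  deterministic bound, leaves room for a strict inequality when the two are combined.\<close>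

lemma window_bound:
  assumes x: "x > 1" and e: "\<epsilon> > 0"
  obtains m where "\<forall>\<^sub>F N in sequentially.
    measure (M N) {\<omega> \<in> space (M N). \<exists>i<N. (x * sqrt (2 * ln (real N)) / (1 + 3 / real (Suc m)))\<^sup>2 \<le>
        (\<Sum>j<Suc m. (a N (Suc ((i + j) mod N)) \<omega>)\<^sup>2 + 2 * (b N (Suc ((i + j) mod N)) \<omega>)\<^sup>2)}
      \<le> exp ((1 - x\<^sup>2 + \<epsilon>) * ln (real N))"
proof -
  \<comment> \<open>The admissible relative loss in the exponent, worth at most
    \<open>\<epsilon> / 2\<close>; the other half of \<open>\<epsilon>\<close> absorbs the moment
    constant.\<close>
  define \<delta> where "\<delta> = min 1 (\<epsilon> / (2 * x\<^sup>2))"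
  have \<delta>: "\<delta> > 0" "\<delta> \<le> 1" "\<delta> * x\<^sup>2 \<le> \<epsilon> / 2"
  proof -
    show "\<delta> > 0" "\<delta> \<le> 1" using e x by (auto simp: \<delta>_def)
    have "\<delta> * x\<^sup>2 \<le> \<epsilon> / (2 * x\<^sup>2) * x\<^sup>2" by (intro mult_right_mono) (auto simp: \<delta>_def)
    then show "\<delta> * x\<^sup>2 \<le> \<epsilon> / 2" using x by simp
  qed
  obtain m where m: "12 / \<delta> \<le> real m" using real_arch_simple by blast
  define k where "k = Suc m"
  define y where "y = 3 / real k"
  have y: "y \<ge> 0" "y \<le> \<delta> / 4"
  proof -
    have "12 / \<delta> \<le> real k" using m by (simp add: k_def)
    then show "y \<le> \<delta> / 4" using \<delta> by (simp add: y_def field_simps k_def)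
  qed (simp add: y_def)
  \<comment> \<open>Below the tail parameter \<open>1 - \<delta> / 4\<close>, so the moments are
    finite, yet large enough that \<open>\<theta> / (1 + y)\<^sup>2 \<ge> 1 - \<delta>\<close> when
    \<open>y \<le> \<delta> / 4\<close>; the choice of \<open>m\<close> ensures the latter.\<close>
  define \<theta> where "\<theta> = 1 - \<delta> / 2"
  have \<theta>: "\<theta> > 0" "\<theta> < 1 - \<delta> / 4" using \<delta> by (auto simp: \<theta>_def)
  have rate: "x\<^sup>2 - \<epsilon> / 2 \<le> \<theta> * x\<^sup>2 / (1 + y)\<^sup>2"
  proof -
    have "(1 - \<delta>) * (1 + y)\<^sup>2 \<le> (1 - \<delta>) * (1 + \<delta> / 4)\<^sup>2"
      using y \<delta> by (intro mult_left_mono power_mono) auto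
    also have "\<dots> \<le> \<theta>"
    proof -
      have "0 \<le> \<delta> * (\<delta> * (7 / 16 + \<delta> / 16))" using \<delta> by (intro mult_nonneg_nonneg) auto
      also have "\<dots> = 1 - \<delta> / 2 - (1 - \<delta>) * (1 + \<delta> / 4)\<^sup>2"
        by (simp add: power2_eq_square field_simps)
      finally show ?thesis by (simp add: \<theta>_def)
    qed
    finally have "1 - \<delta> \<le> \<theta> / (1 + y)\<^sup>2" using y by (simp add: pos_le_divide_eq)
    then have "(1 - \<delta>) * x\<^sup>2 \<le> \<theta> / (1 + y)\<^sup>2 * x\<^sup>2" by (intro mult_right_mono) auto
    with \<delta>(3) show ?thesis by (simp add: algebra_simps)
  qed
  obtain N0 where
    ta: "uniform_gaussian_tail ({N0..} \<times> {1..}) (\<lambda>(N, i). M N) (\<lambda>(N, i). a N i)" and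
    tb: "uniform_gaussian_tail ({N0..} \<times> {1..}) (\<lambda>(N, i). M N) (\<lambda>(N, i) \<omega>. sqrt 2 * b N i \<omega>)"
    using tail by blast
  have \<delta>4: "\<delta> / 4 > 0" using \<delta> by simp
  from uniform_gaussian_tail_array_upper[OF ta \<delta>4] obtain xa where
    xa: "\<forall>x\<ge>xa. \<forall>N\<ge>N0. \<forall>i\<ge>1.
      measure (M N) {\<omega> \<in> space (M N). \<bar>a N i \<omega>\<bar> > x} \<le> exp (- ((1 - \<delta> / 4) * x\<^sup>2 / 2))" ..
  from uniform_gaussian_tail_array_upper[OF tb \<delta>4] obtain xb where
    xb: "\<forall>x\<ge>xb. \<forall>N\<ge>N0. \<forall>i\<ge>1.
      measure (M N) {\<omega> \<in> space (M N). \<bar>sqrt 2 * b N i \<omega>\<bar> > x} \<le> exp (- ((1 - \<delta> / 4) * x\<^sup>2 / 2))" ..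
  obtain C where C: "C \<ge> 1" and moment:
    "\<And>(M :: 'a measure) X. prob_space M \<Longrightarrow> X \<in> borel_measurable M \<Longrightarrow>
      (\<And>x. x \<ge> max xa xb \<Longrightarrow> measure M {\<omega> \<in> space M. \<bar>X \<omega>\<bar> > x} \<le> exp (- ((1 - \<delta> / 4) * x\<^sup>2 / 2))) \<Longrightarrow>
      (\<integral>\<^sup>+\<omega>. ennreal (exp (\<theta> * (X \<omega>)\<^sup>2 / 2)) \<partial>M) \<le> ennreal C"
    using exp_square_moment_bound[OF \<theta>, where 'a = 'a] by blast
  have e2: "\<epsilon> / 2 > 0" using e by simp
  have "\<forall>\<^sub>F N in sequentially.
    measure (M N) {\<omega> \<in> space (M N). \<exists>i<N. (x * sqrt (2 * ln (real N)) / (1 + 3 / real (Suc m)))\<^sup>2 \<le>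
        (\<Sum>j<Suc m. (a N (Suc ((i + j) mod N)) \<omega>)\<^sup>2 + 2 * (b N (Suc ((i + j) mod N)) \<omega>)\<^sup>2)}
      \<le> exp ((1 - x\<^sup>2 + \<epsilon>) * ln (real N))"
    using eventually_ge_at_top[of N0] eventually_ge_at_top[of k] eventually_gt_at_top[of 1]
      eventually_le_mult_ln[OF e2, of "real (2 * k) * ln C"]
  proof eventually_elim
    case (elim N)
    interpret prob_space "M N" by (rule prob)
    define L where "L = ln (real N)"
    have L: "L > 0" "real N = exp L" using elim by (auto simp: L_def)
    define S where "S = (x * sqrt (2 * ln (real N)) / (1 + 3 / real (Suc m)))\<^sup>2"
    have S: "\<theta> * S / 2 = \<theta> * x\<^sup>2 / (1 + y)\<^sup>2 * L"
      using L by (simp add: S_def y_def k_def power_mult_distrib power_divide flip: L_def)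
    define J where "J i = (\<lambda>j. Suc ((i + j) mod N)) ` {..<k}" for i
    define W where "W i \<omega> = (\<Sum>l\<in>J i. (a N l \<omega>)\<^sup>2 + 2 * (b N l \<omega>)\<^sup>2)" for i \<omega>
    have J: "finite (J i)" "J i \<subseteq> {1..}" for i by (auto simp: J_def)
    \<comment> \<open>For \<open>N \<ge> k\<close> a window does not run into itself, so its sum
      involves each variable once and independence applies.\<close>
    have inj: "inj_on (\<lambda>j. Suc ((i + j) mod N)) {..<k}" for i
    proof (rule inj_onI)
      fix j j' assume "j \<in> {..<k}" "j' \<in> {..<k}" "Suc ((i + j) mod N) = Suc ((i + j') mod N)"
      then have "[i + j = i + j'] (mod N)" "j < N" "j' < N" using elim by (auto simp: cong_def)
      then show "j = j'" by (metis cong_add_lcancel_nat cong_less_modulus_unique_nat)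
    qed
    then have W: "(\<Sum>j<Suc m. (a N (Suc ((i + j) mod N)) \<omega>)\<^sup>2 + 2 * (b N (Suc ((i + j) mod N)) \<omega>)\<^sup>2) = W i \<omega>"
      for i \<omega> unfolding W_def J_def by (subst sum.reindex) (auto simp: k_def)
    have card: "card (J i) = k" for i unfolding J_def by (simp add: card_image[OF inj])
    have [measurable]: "W i \<in> borel_measurable (M N)" for i
      unfolding W_def using J by (intro borel_measurable_sum borel_measurable_add borel_measurable_times
          borel_measurable_power borel_measurable_const measurable_a measurable_b) auto
    have window: "prob {\<omega> \<in> space (M N). S \<le> W i \<omega>} \<le> C ^ (2 * k) * exp (- (\<theta> * S / 2))" for i
      unfolding W_def
    proof (rule window_sum_tail[OF indep_a indep_b indep_ab J C, unfolded card])
      fix l assume "l \<in> J i"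
      then have l: "l \<ge> 1" using J by auto
      have [measurable]: "a N l \<in> borel_measurable (M N)" "b N l \<in> borel_measurable (M N)"
        using l by (auto intro: measurable_a measurable_b)
      show "(\<integral>\<^sup>+\<omega>. ennreal (exp (\<theta> * (a N l \<omega>)\<^sup>2 / 2)) \<partial>M N) \<le> ennreal C"
        using xa elim(1) l by (intro moment prob) auto
      show "(\<integral>\<^sup>+\<omega>. ennreal (exp (\<theta> * (sqrt 2 * b N l \<omega>)\<^sup>2 / 2)) \<partial>M N) \<le> ennreal C"
        using xb elim(1) l by (intro moment prob) auto
    qed (rule \<theta>(1))
    have "prob {\<omega> \<in> space (M N). \<exists>i<N. S \<le> W i \<omega>} = prob (\<Union>i<N. {\<omega> \<in> space (M N). S \<le> W i \<omega>})"
      by (intro arg_cong[of _ _ prob]) auto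
    also have "\<dots> \<le> (\<Sum>i<N. prob {\<omega> \<in> space (M N). S \<le> W i \<omega>})"
      by (intro measure_UNION_le) auto
    also have "\<dots> \<le> (\<Sum>i<N. C ^ (2 * k) * exp (- (\<theta> * S / 2)))"
      by (intro sum_mono window)
    also have "\<dots> = exp L * (exp (real (2 * k) * ln C) * exp (- (\<theta> * S / 2)))"
      using C by (simp add: L(2) exp_of_nat_mult[of "2 * k" "ln C"] del: of_nat_mult)
    also have "\<dots> = exp (L + real (2 * k) * ln C - \<theta> * S / 2)"
      by (simp add: mult_exp_exp)
    also have "\<dots> \<le> exp ((1 - x\<^sup>2 + \<epsilon>) * L)"
    proof -
      have "(x\<^sup>2 - \<epsilon> / 2) * L \<le> \<theta> * S / 2"
        unfolding S using rate L by (intro mult_right_mono) auto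
      moreover have "real (2 * k) * ln C \<le> \<epsilon> / 2 * L" using elim(4) by (simp add: L_def)
      moreover have "(1 - x\<^sup>2 + \<epsilon>) * L = L + \<epsilon> / 2 * L - (x\<^sup>2 - \<epsilon> / 2) * L" by (simp add: field_simps)
      ultimately show ?thesis unfolding exp_le_cancel_iff by linarith
    qed
    finally show ?case unfolding W S_def[symmetric] L_def .
  qed
  then show ?thesis by (rule that)
qed

section \<open>From the deterministic bounds to the large deviation principle\<close>

lemma LDP_of_window_bounds:
  fixes \<Lambda> :: "nat \<Rightarrow> 'a \<Rightarrow> real"
  assumes meas: "\<And>N. \<Lambda> N \<in> borel_measurable (M N)"
    and lower: "\<And>N i \<omega>. N \<ge> 3 \<Longrightarrow> i < N \<Longrightarrow> a N (Suc i) \<omega> \<le> \<Lambda> N \<omega>"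
    and upper: "\<And>N m s \<omega>. N \<ge> 3 \<Longrightarrow> s > 0 \<Longrightarrow> (\<And>i. i < N \<Longrightarrow>
      (\<Sum>j<Suc m. (a N (Suc ((i + j) mod N)) \<omega>)\<^sup>2 + 2 * (b N (Suc ((i + j) mod N)) \<omega>)\<^sup>2) \<le> s\<^sup>2) \<Longrightarrow>
      \<Lambda> N \<omega> \<le> (1 + 2 / real (Suc m)) * s"
  shows "satisfies_LDP M (\<lambda>N \<omega>. \<Lambda> N \<omega> / sqrt (2 * ln (real N))) (\<lambda>N. ln (real N)) I2"
proof (rule satisfies_LDP_I2I)
  show "prob_space (M N)" for N by (rule prob)
  show "(\<lambda>\<omega>. \<Lambda> N \<omega> / sqrt (2 * ln (real N))) \<in> borel_measurable (M N)" for N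
    using meas by measurable
  have all_le: "a N i \<omega> \<le> c * sqrt (2 * ln (real N))"
    if "N \<ge> 3" "i \<in> {1..N}" "\<Lambda> N \<omega> / sqrt (2 * ln (real N)) \<le> c" for N i c \<omega>
  proof -
    have "i - 1 < N" "Suc (i - 1) = i" using that by auto
    then have "a N i \<omega> \<le> \<Lambda> N \<omega>" using lower[OF that(1), of "i - 1" \<omega>] by simp
    also have "\<Lambda> N \<omega> \<le> c * sqrt (2 * ln (real N))" using that by (simp add: pos_divide_le_eq)
    finally show ?thesis .
  qed
  show "\<forall>\<^sub>F N in sequentially.
      measure (M N) {\<omega> \<in> space (M N). \<Lambda> N \<omega> / sqrt (2 * ln (real N)) \<le> c} \<le> exp (- K * ln (real N))"
    if c: "c < 1" for c K
  proof -
    \<comment> \<open>\<open>all_le_bound\<close> needs a positive level, and raising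
      \<open>c\<close> only enlarges the event.\<close>
    define c' where "c' = max c (1 / 2)"
    have c': "0 < c'" "c' < 1" "c \<le> c'" using c by (auto simp: c'_def)
    have c'2: "c'\<^sup>2 < 1" "c'\<^sup>2 > 0" using c' by (auto simp: power_less_one_iff abs_square_less_1)
    \<comment> \<open>Puts \<open>(1 + \<epsilon>) * c'\<^sup>2\<close> halfway between
      \<open>c'\<^sup>2\<close> and 1, so that \<open>g > 0\<close>.\<close>
    define \<epsilon> where "\<epsilon> = (1 - c'\<^sup>2) / (2 * c'\<^sup>2)"
    have e: "\<epsilon> > 0" using c'2 by (simp add: \<epsilon>_def)
    define g where "g = 1 - (1 + \<epsilon>) * c'\<^sup>2"
    have "g = (1 - c'\<^sup>2) / 2" using c'2 c' by (simp add: g_def \<epsilon>_def field_simps)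
    then have g: "g > 0" using c'2 by simp
    have "\<forall>\<^sub>F x in at_top. K * x \<le> exp (g * x)" using g by real_asymp
    then have "\<forall>\<^sub>F N in sequentially. K * ln (real N) \<le> exp (g * ln (real N))"
      by (rule eventually_compose_filterlim) real_asymp
    then show ?thesis
      using all_le_bound[OF c'(1) e] eventually_ge_at_top[of 3]
    proof eventually_elim
      case (elim N)
      interpret prob_space "M N" by (rule prob)
      have "prob {\<omega> \<in> space (M N). \<Lambda> N \<omega> / sqrt (2 * ln (real N)) \<le> c}
          \<le> prob {\<omega> \<in> space (M N). \<forall>i\<in>{1..N}. a N i \<omega> \<le> c' * sqrt (2 * ln (real N))}"
      proof (rule finite_measure_mono)
        show "{\<omega> \<in> space (M N). \<forall>i\<in>{1..N}. a N i \<omega> \<le> c' * sqrt (2 * ln (real N))} \<in> events"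
          by (intro sets.sets_Collect_finite_All borel_measurable_le measurable_a borel_measurable_const) auto
        show "{\<omega> \<in> space (M N). \<Lambda> N \<omega> / sqrt (2 * ln (real N)) \<le> c}
            \<subseteq> {\<omega> \<in> space (M N). \<forall>i\<in>{1..N}. a N i \<omega> \<le> c' * sqrt (2 * ln (real N))}"
          using all_le[OF elim(3), of _ _ c'] c'(3) by (auto dest: order_trans)
      qed
      also note elim(2)
      also have "exp (- exp ((1 - (1 + \<epsilon>) * c'\<^sup>2) * ln (real N))) \<le> exp (- K * ln (real N))"
        using elim(1) by (simp add: g_def)
      finally show ?case .
    qed
  qed
  show "\<forall>\<^sub>F N in sequentially. exp ((1 - x\<^sup>2 - \<epsilon>) * ln (real N))
      \<le> measure (M N) {\<omega> \<in> space (M N). x < \<Lambda> N \<omega> / sqrt (2 * ln (real N))}"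
    if x: "x > 1" and e: "\<epsilon> > 0" for x \<epsilon>
  proof -
    \<comment> \<open>Uses up half of \<open>\<epsilon>\<close>; the other half pays for the factor
      1/2 in \<open>1 - exp (- u) \<ge> u / 2\<close>, valid since \<open>u \<le> 1\<close>.\<close>
    define \<epsilon>' where "\<epsilon>' = \<epsilon> / (2 * x\<^sup>2)"
    have e': "\<epsilon>' > 0" "\<epsilon>' * x\<^sup>2 = \<epsilon> / 2" using x e by (auto simp: \<epsilon>'_def)
    have e2: "\<epsilon> / 2 > 0" using e by simp
    have "x > 0" using x by simp
    have x2: "x\<^sup>2 > 1" using x by (simp add: power2_eq_square less_1_mult)
    show ?thesis
      using all_le_bound[OF \<open>x > 0\<close> e'(1)] eventually_ge_at_top[of 3] eventually_le_mult_ln[OF e2, of "ln 2"] eventually_ln_pos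
    proof eventually_elim
      case (elim N)
      interpret prob_space "M N" by (rule prob)
      note [measurable] = meas[of N]
      define L where "L = ln (real N)"
      define u where "u = exp ((1 - (1 + \<epsilon>') * x\<^sup>2) * L)"
      have exponent: "(1 - (1 + \<epsilon>') * x\<^sup>2) * L = (1 - x\<^sup>2 - \<epsilon> / 2) * L"
        using e'(2) by (simp add: algebra_simps)
      have "(1 - x\<^sup>2 - \<epsilon> / 2) * L \<le> 0"
        using x2 e elim(4) by (intro mult_nonpos_nonneg) (auto simp: L_def)
      then have u: "0 < u" "u \<le> 1" by (simp_all add: u_def exponent)
      have "exp ((1 - x\<^sup>2 - \<epsilon>) * L) \<le> exp ((1 - x\<^sup>2 - \<epsilon> / 2) * L - ln 2)"
        using elim(3) by (simp add: L_def algebra_simps)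
      also have "\<dots> = u / 2" by (simp add: u_def exponent exp_diff)
      also have "u / 2 \<le> 1 - exp (- u)"
      proof -
        have "1 \<le> (1 - u / 2) * (1 + u)"
          using u mult_left_mono[of u 1 u] by (simp add: algebra_simps)
        also have "\<dots> \<le> (1 - u / 2) * exp u"
          using u by (intro mult_left_mono exp_ge_add_one_self) auto
        finally show ?thesis by (simp add: exp_minus field_simps)
      qed
      also have "\<dots> \<le> 1 - prob {\<omega> \<in> space (M N). \<Lambda> N \<omega> / sqrt (2 * ln (real N)) \<le> x}"
      proof -
        have "prob {\<omega> \<in> space (M N). \<Lambda> N \<omega> / sqrt (2 * ln (real N)) \<le> x}
            \<le> prob {\<omega> \<in> space (M N). \<forall>i\<in>{1..N}. a N i \<omega> \<le> x * sqrt (2 * ln (real N))}"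
        proof (rule finite_measure_mono)
          show "{\<omega> \<in> space (M N). \<forall>i\<in>{1..N}. a N i \<omega> \<le> x * sqrt (2 * ln (real N))} \<in> events"
            by (intro sets.sets_Collect_finite_All borel_measurable_le measurable_a borel_measurable_const) auto
        qed (use all_le[OF elim(2)] in auto)
        also have "\<dots> \<le> exp (- u)" using elim(1) by (simp add: u_def L_def)
        finally show ?thesis by simp
      qed
      also have "\<dots> = prob (space (M N) - {\<omega> \<in> space (M N). \<Lambda> N \<omega> / sqrt (2 * ln (real N)) \<le> x})"
        by (intro prob_compl[symmetric]) measurable
      also have "space (M N) - {\<omega> \<in> space (M N). \<Lambda> N \<omega> / sqrt (2 * ln (real N)) \<le> x}
          = {\<omega> \<in> space (M N). x < \<Lambda> N \<omega> / sqrt (2 * ln (real N))}" by auto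
      finally show ?case by (simp add: L_def)
    qed
  qed
  show "\<forall>\<^sub>F N in sequentially.
      measure (M N) {\<omega> \<in> space (M N). x \<le> \<Lambda> N \<omega> / sqrt (2 * ln (real N))} \<le> exp ((1 - x\<^sup>2 + \<epsilon>) * ln (real N))"
    if x: "x > 1" and e: "\<epsilon> > 0" for x \<epsilon>
  proof -
    from window_bound[OF x e] obtain m where m: "\<forall>\<^sub>F N in sequentially.
      measure (M N) {\<omega> \<in> space (M N). \<exists>i<N. (x * sqrt (2 * ln (real N)) / (1 + 3 / real (Suc m)))\<^sup>2 \<le>
        (\<Sum>j<Suc m. (a N (Suc ((i + j) mod N)) \<omega>)\<^sup>2 + 2 * (b N (Suc ((i + j) mod N)) \<omega>)\<^sup>2)}
      \<le> exp ((1 - x\<^sup>2 + \<epsilon>) * ln (real N))" by blast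
    then show ?thesis using eventually_ge_at_top[of 3]
    proof eventually_elim
      case (elim N)
      interpret prob_space "M N" by (rule prob)
      define t where "t = x * sqrt (2 * ln (real N))"
      define s where "s = t / (1 + 3 / real (Suc m))"
      define W where "W i \<omega> = (\<Sum>j<Suc m. (a N (Suc ((i + j) mod N)) \<omega>)\<^sup>2 + 2 * (b N (Suc ((i + j) mod N)) \<omega>)\<^sup>2)" for i \<omega>
      have t: "t > 0" using elim(2) x by (simp add: t_def)
      have pos: "1 + 3 / real (Suc m) > 0" by (simp add: add_pos_nonneg)
      have s: "s > 0" "t = (1 + 3 / real (Suc m)) * s" using t pos by (simp_all add: s_def)
      have [measurable]: "W i \<in> borel_measurable (M N)" for i
        unfolding W_def by (intro borel_measurable_sum borel_measurable_add borel_measurable_times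
          borel_measurable_power borel_measurable_const measurable_a measurable_b) auto
      have "prob {\<omega> \<in> space (M N). x \<le> \<Lambda> N \<omega> / sqrt (2 * ln (real N))}
          \<le> prob {\<omega> \<in> space (M N). \<exists>i<N. s\<^sup>2 \<le> W i \<omega>}"
      proof (rule finite_measure_mono)
        show "{\<omega> \<in> space (M N). x \<le> \<Lambda> N \<omega> / sqrt (2 * ln (real N))} \<subseteq> {\<omega> \<in> space (M N). \<exists>i<N. s\<^sup>2 \<le> W i \<omega>}"
        proof safe
          fix \<omega> assume "x \<le> \<Lambda> N \<omega> / sqrt (2 * ln (real N))"
          then have ge: "t \<le> \<Lambda> N \<omega>" using elim(2) by (simp add: t_def pos_le_divide_eq)
          show "\<exists>i<N. s\<^sup>2 \<le> W i \<omega>"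
          proof (rule ccontr)
            assume "\<not> (\<exists>i<N. s\<^sup>2 \<le> W i \<omega>)"
            then have "\<Lambda> N \<omega> \<le> (1 + 2 / real (Suc m)) * s"
              by (intro upper[OF elim(2) s(1)]) (auto simp: W_def not_le less_imp_le simp del: sum.lessThan_Suc)
            \<comment> \<open>Strictness is what contradicts
              \<open>t \<le> \<Lambda> N \<omega>\<close>.\<close>
            also have "\<dots> < (1 + 3 / real (Suc m)) * s"
              using s(1) by (intro mult_strict_right_mono add_strict_left_mono divide_strict_right_mono) auto
            finally show False using ge s(2) by simp
          qed
        qed
      qed measurable
      with elim(1) show ?case unfolding W_def s_def t_def by linarith
    qed
  qed
qed

lemma measurable_tridiag_entry:
  assumes "i < N" "j < N"
  shows "(\<lambda>\<omega>. tridiag N (\<lambda>i. a N i \<omega>) (\<lambda>i. b N i \<omega>) $$ (i, j)) \<in> borel_measurable (M N)"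
proof -
  consider "i = j" | "j = Suc i" | "i = Suc j" | "i \<noteq> j" "j \<noteq> Suc i" "i \<noteq> Suc j" by blast
  then show ?thesis
    using assms by cases (simp_all add: tridiag_def measurable_a measurable_b)
qed

lemma measurable_tridiag_per_entry:
  assumes "i < N" "j < N"
  shows "(\<lambda>\<omega>. tridiag_per N (\<lambda>i. a N i \<omega>) (\<lambda>i. b N i \<omega>) $$ (i, j)) \<in> borel_measurable (M N)"
proof (cases "i = 0 \<and> j = N - 1 \<or> i = N - 1 \<and> j = 0")
  case True
  then have "tridiag_per N (\<lambda>i. a N i \<omega>) (\<lambda>i. b N i \<omega>) $$ (i, j) = b N N \<omega>" for \<omega>
    using assms by (simp add: tridiag_per_def)
  then show ?thesis using assms by (simp add: measurable_b)
next
  case False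
  then have "tridiag_per N (\<lambda>i. a N i \<omega>) (\<lambda>i. b N i \<omega>) $$ (i, j)
      = tridiag N (\<lambda>i. a N i \<omega>) (\<lambda>i. b N i \<omega>) $$ (i, j)" for \<omega>
    using assms by (auto simp: tridiag_per_def)
  then show ?thesis using measurable_tridiag_entry[OF assms] by simp
qed

lemma LDP_tridiag:
  "satisfies_LDP M
     (\<lambda>N \<omega>. lambda_max (tridiag N (\<lambda>i. a N i \<omega>) (\<lambda>i. b N i \<omega>)) / sqrt (2 * ln (real N)))
     (\<lambda>N. ln (real N)) I2"
proof (rule LDP_of_window_bounds)
  show "(\<lambda>\<omega>. lambda_max (tridiag N (\<lambda>i. a N i \<omega>) (\<lambda>i. b N i \<omega>))) \<in> borel_measurable (M N)" for N
    by (rule borel_measurable_lambda_max[OF tridiag_carrier transpose_tridiag measurable_tridiag_entry])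
  show "a N (Suc i) \<omega> \<le> lambda_max (tridiag N (\<lambda>i. a N i \<omega>) (\<lambda>i. b N i \<omega>))"
    if "N \<ge> 3" "i < N" for N i \<omega>
    by (rule le_lambda_max_tridiag[where a = "\<lambda>i. a N i \<omega>"]) (fact that)+
  show "lambda_max (tridiag N (\<lambda>i. a N i \<omega>) (\<lambda>i. b N i \<omega>)) \<le> (1 + 2 / real (Suc m)) * s"
    if "N \<ge> 3" "s > 0" "\<And>i. i < N \<Longrightarrow>
      (\<Sum>j<Suc m. (a N (Suc ((i + j) mod N)) \<omega>)\<^sup>2 + 2 * (b N (Suc ((i + j) mod N)) \<omega>)\<^sup>2) \<le> s\<^sup>2"
    for N m s \<omega>
    by (rule lambda_max_tridiag_le[OF that])
qed

lemma LDP_tridiag_per: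
  "satisfies_LDP M
     (\<lambda>N \<omega>. lambda_max (tridiag_per N (\<lambda>i. a N i \<omega>) (\<lambda>i. b N i \<omega>)) / sqrt (2 * ln (real N)))
     (\<lambda>N. ln (real N)) I2"
proof (rule LDP_of_window_bounds)
  show "(\<lambda>\<omega>. lambda_max (tridiag_per N (\<lambda>i. a N i \<omega>) (\<lambda>i. b N i \<omega>))) \<in> borel_measurable (M N)" for N
    by (rule borel_measurable_lambda_max[OF tridiag_per_carrier transpose_tridiag_per measurable_tridiag_per_entry])
  show "a N (Suc i) \<omega> \<le> lambda_max (tridiag_per N (\<lambda>i. a N i \<omega>) (\<lambda>i. b N i \<omega>))"
    if "N \<ge> 3" "i < N" for N i \<omega>
    by (rule le_lambda_max_tridiag_per[where a = "\<lambda>i. a N i \<omega>"]) (fact that)+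
  show "lambda_max (tridiag_per N (\<lambda>i. a N i \<omega>) (\<lambda>i. b N i \<omega>)) \<le> (1 + 2 / real (Suc m)) * s"
    if "N \<ge> 3" "s > 0" "\<And>i. i < N \<Longrightarrow>
      (\<Sum>j<Suc m. (a N (Suc ((i + j) mod N)) \<omega>)\<^sup>2 + 2 * (b N (Suc ((i + j) mod N)) \<omega>)\<^sup>2) \<le> s\<^sup>2"
    for N m s \<omega>
    by (rule lambda_max_tridiag_per_le[OF that])
qed

end

theorem theorem1p10:
  fixes M :: "nat \<Rightarrow> 'a measure"
    and a b :: "nat \<Rightarrow> nat \<Rightarrow> 'a \<Rightarrow> real"
  assumes prob: "\<And>N. prob_space (M N)"
    and indep_a: "\<And>N. prob_space.indep_vars (M N) (\<lambda>_. borel) (a N) {1..}"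
    and indep_b: "\<And>N. prob_space.indep_vars (M N) (\<lambda>_. borel) (b N) {1..}"
    and indep_ab: "\<And>N. prob_space.indep_var (M N)
          (\<Pi>\<^sub>M i\<in>{1..}. borel) (\<lambda>\<omega>. \<lambda>i\<in>{1..}. a N i \<omega>)
          (\<Pi>\<^sub>M i\<in>{1..}. borel) (\<lambda>\<omega>. \<lambda>i\<in>{1..}. b N i \<omega>)"
    and tail: "\<exists>N0.
          uniform_gaussian_tail ({N0..} \<times> {1..}) (\<lambda>(N, i). M N) (\<lambda>(N, i). a N i) \<and>
          uniform_gaussian_tail ({N0..} \<times> {1..}) (\<lambda>(N, i). M N) (\<lambda>(N, i) \<omega>. sqrt 2 * b N i \<omega>)"
  shows "satisfies_LDP M
           (\<lambda>N \<omega>. lambda_max (tridiag N (\<lambda>i. a N i \<omega>) (\<lambda>i. b N i \<omega>)) / sqrt (2 * ln (real N)))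
           (\<lambda>N. ln (real N)) I2 \<and>
         satisfies_LDP M
           (\<lambda>N \<omega>. lambda_max (tridiag_per N (\<lambda>i. a N i \<omega>) (\<lambda>i. b N i \<omega>)) / sqrt (2 * ln (real N)))
           (\<lambda>N. ln (real N)) I2"
proof -
  interpret gaussian_tail_entries M a b
    by (rule gaussian_tail_entries.intro[OF assms])
  show ?thesis using LDP_tridiag LDP_tridiag_per ..
qed

end
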